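(* For every integer $r\ge 3$ and all $\varepsilon,\delta>0$ the following holds. Suppose that $n_1,\dots,n_\ell$ are integers, each at least $2r/\varepsilon$, whose sum is at most $n$, and with $n_1\ge\delta n$. Then for any $p=p(n)$ with $n^{-1+\varepsilon}<p\le 1$, the random $r$-uniform hypergraph $\mathcal{G}^{(r)}(n,p)$ contains a collection of vertex disjoint tight cycles of lengths $n_1,\ldots,n_\ell$ with probability tending to one as $n$ tends to infinity.
   Context: The random $r$-uniform hypergraph $\mathcal{G}^{(r)}(n,p)$ on vertex set $[n]$ includes each $r$-subset of $[n]$ as an edge independently with probability $p$. A tight cycle of length $m$ in an $r$-uniform hypergraph is a cyclic sequence $x_1,\dots,x_m$ of $m$ distinct vertices such that $\{x_{i+1},\dots,x_{i+r}\}$ is an edge for every $i$, indices taken modulo $m$. *)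

theory Defs
  imports "HOL-Probability.Probability" "HOL-Probability.Product_PMF"
begin

definition r_subsets :: "nat \<Rightarrow> 'a set \<Rightarrow> 'a set set" where
  "r_subsets r V = {e. e \<subseteq> V \<and> card e = r}"

text \<open>
  A hypergraph on a vertex set is represented by its set of edges.  The edge indicators are drawn
  independently; the value \<^term>\<open>False\<close> is only the default outside the finite index set.  Note that
  \<^const>\<open>bernoulli_pmf\<close> truncates its parameter to the interval from 0 to 1.
\<close>

definition random_hypergraph :: "nat \<Rightarrow> nat \<Rightarrow> real \<Rightarrow> nat set set pmf" where
  "random_hypergraph r n p =
     map_pmf (\<lambda>f. {e \<in> r_subsets r {1..n}. f e})
       (Pi_pmf (r_subsets r {1..n}) False (\<lambda>_. bernoulli_pmf p))"

text \<open>
  The cycle is the list of its vertices, indexed from 0, and its length is the length of the list.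
\<close>

definition tight_cycle :: "nat \<Rightarrow> 'a set \<Rightarrow> 'a set set \<Rightarrow> 'a list \<Rightarrow> bool" where
  "tight_cycle r V E xs \<longleftrightarrow>
     xs \<noteq> [] \<and> distinct xs \<and> set xs \<subseteq> V \<and>
     (\<forall>i < length xs. (\<lambda>j. xs ! ((i + j) mod length xs)) ` {1..r} \<in> E)"

definition has_disjoint_tight_cycles :: "nat \<Rightarrow> 'a set \<Rightarrow> 'a set set \<Rightarrow> nat list \<Rightarrow> bool" where
  "has_disjoint_tight_cycles r V E ms \<longleftrightarrow>
     (\<exists>Cs. length Cs = length ms \<and>
        (\<forall>i < length ms. tight_cycle r V E (Cs ! i) \<and> length (Cs ! i) = ms ! i) \<and>
        (\<forall>i < length ms. \<forall>j < length ms. i \<noteq> j \<longrightarrow> set (Cs ! i) \<inter> set (Cs ! j) = {}))"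

end

theory Submission
  imports Defs "HOL-Combinatorics.Permutations"
begin

text \<open>
  Second moment method.  Let \<open>F\<close> be a fixed disjoint union of tight cycles of the given lengths and
  let \<open>X\<close> count the permutations \<open>\<sigma>\<close> of the vertices with \<open>\<sigma>F\<close> contained in the random
  hypergraph.  By Chebyshev's inequality, \<open>X = 0\<close> has probability at most
  the average of \<open>p\<close> to the power \<open>-|\<sigma>F \<inter> F|\<close> over all \<open>\<sigma>\<close>, minus one.  Expanding this power gives
  a sum over the sets \<open>S\<close> of edges of \<open>F\<close> that \<open>\<sigma>\<close> maps into \<open>F\<close>.  If \<open>S\<close> has \<open>k\<close> edges and covers \<open>v\<close>
  vertices in \<open>c\<close> components, the summand is at most (constant to the power \<open>k\<close>) times
  \<open>n\<close> to the power \<open>c - v + (1 - \<epsilon>) k\<close>, because \<open>\<sigma>\<close> is determined on a component by the image of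
  one vertex and the orders in which edges are mapped.  A component that is not a whole cycle has
  \<open>v \<ge> k + r - 1\<close>, so for \<open>r \<ge> 3\<close> the components with a given first edge contribute \<open>o(1/n)\<close> in
  total; a component that is a whole cycle is negligible because its length is at least \<open>2r/\<epsilon>\<close>.
\<close>

subsection \<open>Sets of edges of one tight cycle\<close>

text \<open>A set of edges of a tight cycle of length \<open>m\<close> is represented by the set of their indices,
  where the edge with index \<open>i\<close> begins at position \<open>i + 1\<close>.\<close>

definition edge_positions :: "nat \<Rightarrow> nat \<Rightarrow> nat \<Rightarrow> nat set" where
  "edge_positions m r i = (\<lambda>j. (i + j) mod m) ` {1..r}"

definition cover :: "nat \<Rightarrow> nat \<Rightarrow> nat set \<Rightarrow> nat set" where
  "cover m r S = (\<Union>i\<in>S. edge_positions m r i)"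

text \<open>Cut the cyclic set \<open>S\<close> wherever at least \<open>r - 1\<close> consecutive
  indices are missing; these are the first indices of the resulting runs. A nonempty
  \<open>S\<close> without such a gap has none: its edges close up around the cycle. The form
  \<open>m - g\<close> is a step back by \<open>g\<close> without truncated subtraction.\<close>

definition starts :: "nat \<Rightarrow> nat \<Rightarrow> nat set \<Rightarrow> nat set" where
  "starts m r S = {i \<in> S. \<forall>g\<in>{1..<r}. (i + (m - g)) mod m \<notin> S}"

lemma edge_positionsI: "a \<in> {1..r} \<Longrightarrow> (i + a) mod m \<in> edge_positions m r i"
  by (auto simp: edge_positions_def)

lemma cover_subset: "m > 0 \<Longrightarrow> cover m r S \<subseteq> {..<m}"
  by (auto simp: cover_def edge_positions_def)

lemma starts_subset: "starts m r S \<subseteq> S"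
  by (auto simp: starts_def)

lemma mod_add_left_cancel_nat:
  fixes a b c m :: nat
  assumes "(c + a) mod m = (c + b) mod m"
  shows "a mod m = b mod m"
  using assms by (auto simp: nat_mod_eq_iff algebra_simps)

lemma mod_eq_shift_back:
  fixes i j a b m :: nat
  assumes "i < m" "a \<le> b" "b - a \<le> m" and eq: "(i + b) mod m = (j + a) mod m"
  shows "i = (j + (m - (b - a))) mod m"
proof -
  have "(a + (i + (b - a))) mod m = (a + j) mod m"
    using eq assms(2) by (simp add: algebra_simps)
  then have "(i + (b - a)) mod m = j mod m"
    by (rule mod_add_left_cancel_nat)
  then have "(i + (b - a) + (m - (b - a))) mod m = (j + (m - (b - a))) mod m"
    by (metis mod_add_left_eq)
  then show ?thesis using assms by simp
qed

text \<open>Every index contributes its last position \<open>i + r\<close>, every start also its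
  other \<open>r - 1\<close> positions. These are all distinct: equal offsets separate distinct
  indices, and a coincidence of different offsets would put an index of \<open>S\<close> fewer than
  \<open>r\<close> steps before a start.\<close>

lemma card_cover_ge:
  assumes S: "S \<subseteq> {..<m}" and r: "r \<ge> 1" "r \<le> m"
  shows "card S + (r - 1) * card (starts m r S) \<le> card (cover m r S)"
proof (cases "m = 0")
  case True
  then show ?thesis using assms by auto
next
  case False
  define T where "T = starts m r S"
  define A where "A = (\<lambda>i. (i + r) mod m) ` S"
  define B where "B = (\<lambda>(i, a). (i + a) mod m) ` (T \<times> {1..<r})"
  have fS: "finite S" using S finite_subset by auto
  have T: "T \<subseteq> S" by (auto simp: T_def starts_def)
  have fT: "finite T" using T fS finite_subset by auto
  have start: False if "i \<in> T" "j \<in> S" "a < b" "b \<le> r" "b - a < r" "(j + b) mod m = (i + a) mod m" for i j a b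
  proof -
    have "j = (i + (m - (b - a))) mod m"
      using that S r by (intro mod_eq_shift_back) auto
    moreover have "b - a \<in> {1..<r}" using that by auto
    ultimately show False using that unfolding T_def starts_def by blast
  qed
  have injA: "inj_on (\<lambda>i. (i + r) mod m) S"
  proof (rule inj_onI)
    fix i j assume "i \<in> S" "j \<in> S" "(i + r) mod m = (j + r) mod m"
    then have "i mod m = j mod m" using mod_add_left_cancel_nat[of r i m j] by (simp add: add.commute)
    moreover have "i < m" "j < m" using S \<open>i \<in> S\<close> \<open>j \<in> S\<close> by auto
    ultimately show "i = j" by simp
  qed
  have injB: "inj_on (\<lambda>(i, a). (i + a) mod m) (T \<times> {1..<r})"
  proof (rule inj_onI, clarify)
    fix i a j b assume h: "i \<in> T" "a \<in> {1..<r}" "j \<in> T" "b \<in> {1..<r}" "(i + a) mod m = (j + b) mod m"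
    have S': "i \<in> S" "j \<in> S" using h T by auto
    have "\<not> a < b"
    proof
      assume "a < b"
      then show False using h by (intro start[OF h(1) S'(2) _ _ _ h(5)[symmetric]]) auto
    qed
    moreover have "\<not> b < a"
    proof
      assume "b < a"
      then show False using h by (intro start[OF h(3) S'(1) _ _ _ h(5)]) auto
    qed
    ultimately have [simp]: "a = b" by simp
    have "i mod m = j mod m" using h mod_add_left_cancel_nat[of a i m j] by (simp add: add.commute)
    moreover have "i < m" "j < m" using S T h by auto
    ultimately show "i = j \<and> a = b" by simp
  qed
  have "A \<inter> B = {}"
  proof (rule ccontr)
    assume "A \<inter> B \<noteq> {}"
    then obtain i j a where "j \<in> S" "i \<in> T" "a \<in> {1..<r}" "(j + r) mod m = (i + a) mod m"
      unfolding A_def B_def by fast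
    then show False using start[of i j a r] by auto
  qed
  moreover have "A \<union> B \<subseteq> cover m r S"
    using T r by (force simp: A_def B_def cover_def edge_positions_def)
  moreover have "card A = card S" unfolding A_def by (rule card_image[OF injA])
  moreover have "card B = (r - 1) * card T"
    unfolding B_def card_image[OF injB] using fT by (simp add: card_cartesian_product)
  moreover have "finite A" "finite B" by (auto simp: A_def B_def fS fT)
  moreover have "finite (cover m r S)" using fS by (auto simp: cover_def edge_positions_def)
  ultimately show ?thesis unfolding T_def
    by (metis card_Un_disjoint card_mono)
qed

text \<open>From an uncovered \<open>x\<close>, walk forward to the first index \<open>i\<close> of
  \<open>S\<close>. As \<open>i\<close> is not a start, an index of \<open>S\<close> lies
  \<open>g < r\<close> steps before it. Either that index is not before \<open>x\<close>, against
  the choice of \<open>i\<close>, or it is before \<open>x\<close> and its edge reaches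
  \<open>x\<close>.\<close>

lemma cover_eq_if_no_starts:
  assumes S: "S \<subseteq> {..<m}" "S \<noteq> {}" and r: "r \<le> m" and no: "starts m r S = {}"
  shows "cover m r S = {..<m}"
proof (rule antisym[OF cover_subset], goal_cases)
  case 1
  then show ?case using S by (cases m) auto
next
  case 2
  show ?case
  proof (rule subsetI, rule ccontr)
    fix x assume x: "x \<in> {..<m}" and notin: "x \<notin> cover m r S"
    obtain s where s: "s \<in> S" using S by auto
    have "(x + (s + m - x)) mod m = s" using S(1) s x by auto
    then have ex: "\<exists>d. (x + d) mod m \<in> S" using s by metis
    define d where "d = (LEAST d. (x + d) mod m \<in> S)"
    define i where "i = (x + d) mod m"
    have iS: "i \<in> S" unfolding i_def d_def by (rule LeastI_ex[OF ex])
    have min: "(x + d') mod m \<notin> S" if "d' < d" for d'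
      using not_less_Least that unfolding d_def by blast
    obtain g where g: "g \<in> {1..<r}" and gS: "(i + (m - g)) mod m \<in> S"
      using iS no by (auto simp: starts_def)
    have mg: "g \<le> m" using g r by auto
    show False
    proof (cases "g \<le> d")
      case True
      have "(i + (m - g)) mod m = (x + d + (m - g)) mod m"
        unfolding i_def by (simp add: mod_add_left_eq)
      also have "x + d + (m - g) = x + (d - g) + m" using True mg by simp
      finally have "(i + (m - g)) mod m = (x + (d - g)) mod m" by simp
      with gS min[of "d - g"] g True show False by auto
    next
      case False
      have "((i + (m - g)) mod m + (g - d)) mod m = (i + (m - g) + (g - d)) mod m"
        by (simp add: mod_add_left_eq)
      also have "\<dots> = (x + d + ((m - g) + (g - d))) mod m"
        unfolding i_def by (metis mod_add_left_eq add.assoc)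
      also have "x + d + ((m - g) + (g - d)) = x + m" using False mg by simp
      finally have "x = ((i + (m - g)) mod m + (g - d)) mod m" using x by simp
      moreover have "g - d \<in> {1..r}" using False g by auto
      ultimately have "x \<in> cover m r S"
        using gS unfolding cover_def by (metis UN_I edge_positionsI)
      with notin show False by simp
    qed
  qed
qed

text \<open>Walk around the cycle from \<open>t\<close>. An edge of \<open>S\<close> that is not a
  start has its first position inside an earlier edge of \<open>S\<close>, so \<open>P\<close>
  passes on; at a start it is given. The edge \<open>t\<close> begins the walk and also serves when
  there is no start at all.\<close>

lemma cover_propagate:
  assumes S: "S \<subseteq> {..<m}" and r: "r \<ge> 1" "r \<le> m"
    and closed: "\<And>i x y. i \<in> S \<Longrightarrow> x \<in> edge_positions m r i \<Longrightarrow> y \<in> edge_positions m r i \<Longrightarrow> P x \<Longrightarrow> P y"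
    and t: "t \<in> S" "P ((t + 1) mod m)"
    and st: "\<And>i. i \<in> starts m r S \<Longrightarrow> P ((i + 1) mod m)"
    and x: "x \<in> cover m r S"
  shows "P x"
proof -
  have all: "P y" if "i \<in> S" "P ((i + 1) mod m)" "y \<in> edge_positions m r i" for i y
    using closed[OF that(1) _ that(3) that(2)] edge_positionsI[of 1 r i m] r(1) by auto
  have tm: "t < m" using t S by auto
  have walk: "\<forall>y\<in>edge_positions m r ((t + d) mod m). P y" if "(t + d) mod m \<in> S" "d < m" for d
    using that
  proof (induction d rule: less_induct)
    case (less d)
    define i where "i = (t + d) mod m"
    have step: "P ((i + 1) mod m)" if g: "g \<in> {1..<r}" "g \<le> d" "(t + (d - g)) mod m \<in> S" for g
    proof -
      have "\<forall>y\<in>edge_positions m r ((t + (d - g)) mod m). P y"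
        using less.IH[of "d - g"] g less.prems by auto
      \<comment> \<open>The first position of edge \<open>i\<close> has offset
        \<open>g + 1 \<le> r\<close> in the edge that begins \<open>g\<close> steps earlier.\<close>
      moreover have "((t + (d - g)) mod m + (g + 1)) mod m \<in> edge_positions m r ((t + (d - g)) mod m)"
        using g by (intro edge_positionsI) auto
      moreover have "((t + (d - g)) mod m + (g + 1)) mod m = (i + 1) mod m"
        using g mod_add_left_eq[of "t + (d - g)" m "g + 1"] mod_add_left_eq[of "t + d" m 1]
        unfolding i_def by simp
      ultimately show ?thesis by metis
    qed
    have "P ((i + 1) mod m)"
    proof (cases "d = 0")
      case True
      then show ?thesis using t tm by (simp add: i_def)
    next
      case False
      show ?thesis
      proof (cases "i \<in> starts m r S")
        case True
        then show ?thesis by (rule st)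
      next
        case notst: False
        then obtain g where g: "g \<in> {1..<r}" "(i + (m - g)) mod m \<in> S"
          using less.prems by (auto simp: starts_def i_def)
        show ?thesis
        proof (cases "g \<le> d")
          case True
          have "(i + (m - g)) mod m = (t + d + (m - g)) mod m"
            unfolding i_def by (simp add: mod_add_left_eq)
          also have "t + d + (m - g) = t + (d - g) + m" using True g r by auto
          finally have "(i + (m - g)) mod m = (t + (d - g)) mod m" by simp
          with g True step show ?thesis by metis
        next
          \<comment> \<open>The earlier edge begins before \<open>t\<close>, hence outside the part
            already walked. But then \<open>t\<close> itself is only \<open>d < r\<close> steps
            before \<open>i\<close> and takes its place.\<close>
          case gd: False
          then show ?thesis using step[of d] t tm g False by auto
        qed
      qed
    qed
    then show ?case using all less.prems unfolding i_def by blast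
  qed
  obtain i where i: "i \<in> S" "x \<in> edge_positions m r i" using x by (auto simp: cover_def)
  have im: "i < m" using S i by auto
  show ?thesis
  proof (cases "t \<le> i")
    case True
    then show ?thesis using walk[of "i - t"] i im by auto
  next
    case False
    then show ?thesis using walk[of "i + m - t"] i im tm by auto
  qed
qed

subsection \<open>Summing the weights over all sets of edges\<close>

lemma sum_Pow_insert:
  assumes "finite A" "x \<notin> A"
  shows "sum f (Pow (insert x A)) = sum f (Pow A) + (\<Sum>S\<in>Pow A. f (insert x S))"
proof -
  have "inj_on (insert x) (Pow A)"
    using assms(2) by (auto simp: inj_on_def)
  moreover have "Pow A \<inter> insert x ` Pow A = {}" using assms(2) by auto
  ultimately show ?thesis
    using assms by (simp add: Pow_insert sum.union_disjoint sum.reindex)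
qed

text \<open>On a line, an element that continues a run is charged \<open>\<alpha>\<close> and one
  that begins a run \<open>\<beta>\<close>. Taking \<open>\<beta> = \<alpha> * \<gamma>\<close>
  later charges \<open>\<gamma>\<close> for every start.\<close>

definition link_weight :: "nat \<Rightarrow> real \<Rightarrow> real \<Rightarrow> nat set \<Rightarrow> nat \<Rightarrow> real" where
  "link_weight r \<alpha> \<beta> A i = (if \<exists>a\<in>A. a < i \<and> i < a + r then \<alpha> else \<beta>)"

text \<open>The second factor on the right is the potential that makes the induction work: it accounts
  for the positions at which the next element is still charged \<open>\<alpha>\<close> rather than \<open>\<beta>\<close>.\<close>

lemma sum_link_weight_le:
  fixes \<alpha> \<beta> :: real
  assumes D: "D \<subseteq> {..<j}" and pos: "0 \<le> \<alpha>" "0 \<le> \<beta>" and small: "2 * \<alpha> * real r \<le> 1"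
  shows "(\<Sum>S\<in>Pow {j..<j+k}. \<Prod>i\<in>S. link_weight r \<alpha> \<beta> (D \<union> S) i)
     \<le> (1 + 2 * \<beta>) ^ k * (1 + 2 * \<alpha> * real (card {x. j \<le> x \<and> (\<exists>a\<in>D. x < a + r)}))"
  using D
proof (induction k arbitrary: j D)
  case 0
  then show ?case using pos by simp
next
  case (Suc k)
  \<comment> \<open>The positions from \<open>j\<close> on that are still in reach of an element of
    \<open>D\<close>; their number drives the potential.\<close>
  define near where "near = (\<lambda>j (D :: nat set). {x. j \<le> x \<and> (\<exists>a\<in>D. x < a + r)})"
  define N where "N = (\<lambda>j D. real (card (near j D)))"
  define c where "c = link_weight r \<alpha> \<beta> D j"
  define B where "B = (1 + 2 * \<beta>) ^ k"
  have B: "B \<ge> 1" unfolding B_def using pos by simp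
  have c0: "0 \<le> c" using pos by (auto simp: c_def link_weight_def)
  have fnear: "finite (near j' D)" for j'
  proof (rule finite_subset)
    show "near j' D \<subseteq> {..<j + r}" using Suc.prems by (force simp: near_def)
  qed simp
  \<comment> \<open>Decide about \<open>j\<close> first: it is either left out, or chosen at price
    \<open>c\<close>, after which it joins the earlier elements.\<close>
  have ins: "{j..<j + Suc k} = insert j {Suc j..<Suc j + k}" by auto
  have "(\<Sum>S\<in>Pow {j..<j + Suc k}. \<Prod>i\<in>S. link_weight r \<alpha> \<beta> (D \<union> S) i)
    = (\<Sum>S\<in>Pow {Suc j..<Suc j + k}. \<Prod>i\<in>S. link_weight r \<alpha> \<beta> (D \<union> S) i)
      + (\<Sum>S\<in>Pow {Suc j..<Suc j + k}. \<Prod>i\<in>insert j S. link_weight r \<alpha> \<beta> (D \<union> insert j S) i)"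
    unfolding ins by (rule sum_Pow_insert) auto
  also have "(\<Sum>S\<in>Pow {Suc j..<Suc j + k}. \<Prod>i\<in>insert j S. link_weight r \<alpha> \<beta> (D \<union> insert j S) i)
     = (\<Sum>S\<in>Pow {Suc j..<Suc j + k}. c * (\<Prod>i\<in>S. link_weight r \<alpha> \<beta> (insert j D \<union> S) i))"
  proof (rule sum.cong[OF refl])
    fix S assume S: "S \<in> Pow {Suc j..<Suc j + k}"
    have "finite S" "j \<notin> S" using S by (auto intro: finite_subset)
    moreover have "link_weight r \<alpha> \<beta> (D \<union> insert j S) j = c"
      unfolding c_def link_weight_def using S by (intro if_cong) auto
    ultimately show "(\<Prod>i\<in>insert j S. link_weight r \<alpha> \<beta> (D \<union> insert j S) i)
        = c * (\<Prod>i\<in>S. link_weight r \<alpha> \<beta> (insert j D \<union> S) i)"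
      by simp
  qed
  also have "(\<Sum>S\<in>Pow {Suc j..<Suc j + k}. c * (\<Prod>i\<in>S. link_weight r \<alpha> \<beta> (insert j D \<union> S) i))
     = c * (\<Sum>S\<in>Pow {Suc j..<Suc j + k}. \<Prod>i\<in>S. link_weight r \<alpha> \<beta> (insert j D \<union> S) i)"
    by (simp add: sum_distrib_left)
  also have "(\<Sum>S\<in>Pow {Suc j..<Suc j + k}. \<Prod>i\<in>S. link_weight r \<alpha> \<beta> (D \<union> S) i)
      + c * (\<Sum>S\<in>Pow {Suc j..<Suc j + k}. \<Prod>i\<in>S. link_weight r \<alpha> \<beta> (insert j D \<union> S) i)
      \<le> B * (1 + 2 * \<alpha> * N (Suc j) D) + c * (B * (1 + 2 * \<alpha> * N (Suc j) (insert j D)))"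
    unfolding B_def N_def near_def
    by (intro add_mono mult_left_mono Suc.IH c0) (use Suc.prems in auto)
  also have "\<dots> \<le> B * (1 + 2 * \<alpha> * N (Suc j) D) + c * (B * 2)"
  proof -
    \<comment> \<open>All elements of \<open>insert j D\<close> are at most \<open>j\<close>, so at
      most \<open>r\<close> later positions are in reach, and \<open>small\<close> bounds the
      potential by 2.\<close>
    have "near (Suc j) (insert j D) \<subseteq> {Suc j..<j + r}"
      using Suc.prems by (force simp: near_def)
    then have "card (near (Suc j) (insert j D)) \<le> card {Suc j..<j + r}" by (rule card_mono[rotated]) simp
    then have "N (Suc j) (insert j D) \<le> real r" unfolding N_def by simp
    then have "2 * \<alpha> * N (Suc j) (insert j D) \<le> 2 * \<alpha> * real r" using pos by (intro mult_left_mono) auto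
    then have "1 + 2 * \<alpha> * N (Suc j) (insert j D) \<le> 2" using small by linarith
    then show ?thesis using c0 B by (intro add_left_mono mult_left_mono) auto
  qed
  also have "\<dots> = B * (1 + 2 * \<alpha> * N (Suc j) D + 2 * c)" by (simp add: algebra_simps)
  also have "\<dots> \<le> B * ((1 + 2 * \<beta>) * (1 + 2 * \<alpha> * N j D))"
  proof (rule mult_left_mono)
    show "1 + 2 * \<alpha> * N (Suc j) D + 2 * c \<le> (1 + 2 * \<beta>) * (1 + 2 * \<alpha> * N j D)"
    \<comment> \<open>If \<open>j\<close> is in reach, moving past it lowers the potential by
      \<open>2 * \<alpha>\<close>, which pays for choosing it. Otherwise the new factor
      \<open>1 + 2 * \<beta>\<close> pays.\<close>
    proof (cases "\<exists>a\<in>D. a < j \<and> j < a + r")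
      case True
      then have "near j D = insert j (near (Suc j) D)"
        using le_eq_less_or_eq by (auto simp: near_def)
      moreover have "j \<notin> near (Suc j) D" by (auto simp: near_def)
      ultimately have "N j D = N (Suc j) D + 1" unfolding N_def using fnear by simp
      moreover have "c = \<alpha>" unfolding c_def link_weight_def using True by (rule if_P)
      ultimately have "1 + 2 * \<alpha> * N (Suc j) D + 2 * c = 1 * (1 + 2 * \<alpha> * N j D)"
        by (simp add: algebra_simps)
      also have "\<dots> \<le> (1 + 2 * \<beta>) * (1 + 2 * \<alpha> * N j D)"
        using pos unfolding N_def by (intro mult_right_mono) auto
      finally show ?thesis .
    next
      case False
      have "near (Suc j) D \<subseteq> near j D" by (auto simp: near_def)
      then have NN: "N (Suc j) D \<le> N j D" unfolding N_def using fnear by (simp add: card_mono)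
      have "c = \<beta>" unfolding c_def link_weight_def using False by (rule if_not_P)
      moreover have "2 * \<alpha> * N (Suc j) D \<le> 2 * \<alpha> * N j D" using NN pos by (intro mult_left_mono) auto
      moreover have "0 \<le> 2 * \<beta> * (2 * \<alpha> * N j D)" using pos unfolding N_def by simp
      ultimately show ?thesis by (simp add: algebra_simps)
    qed
  qed (use B in simp)
  also have "\<dots> = (1 + 2 * \<beta>) ^ Suc k * (1 + 2 * \<alpha> * N j D)"
    unfolding B_def by simp
  finally show ?case unfolding N_def near_def .
qed

text \<open>Unrolling the cycle from a start \<open>t\<close> turns cyclic starts into linear ones.\<close>

lemma weight_le_link_weights:
  fixes \<alpha> \<gamma> :: real
  assumes S: "S \<subseteq> {..<m}" and r: "r \<le> m" and t: "t \<in> starts m r S"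
    and pos: "0 \<le> \<alpha>" "0 \<le> \<gamma>" "\<gamma> \<le> 1"
  defines "L \<equiv> {x \<in> {t+1..<t+m}. x mod m \<in> S}"
  shows "\<alpha> ^ card S * \<gamma> ^ card (starts m r S)
    \<le> \<alpha> * \<gamma> * (\<Prod>i\<in>L. link_weight r \<alpha> (\<alpha> * \<gamma>) ({t} \<union> L) i)"
proof -
  have tS: "t \<in> S" and tm: "t < m" using t S by (auto simp: starts_def)
  have fL: "finite L" and tL: "t \<notin> L" by (auto simp: L_def)
  have fS: "finite S" using S finite_subset by auto
  define U where "U = {i\<in>L. \<not> (\<exists>a\<in>{t} \<union> L. a < i \<and> i < a + r)}"
  have inj: "inj_on (\<lambda>x. x mod m) (insert t L)"
  proof (rule inj_onI)
    have *: "x = y" if "x \<le> y" "x \<in> insert t L" "y \<in> insert t L" "x mod m = y mod m" for x y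
    proof -
      have "m dvd y - x" using that mod_eq_dvd_iff_nat[OF that(1), of m] by simp
      moreover have "y - x < m" using that tm by (auto simp: L_def)
      ultimately have "y - x = 0" using nat_dvd_not_less[of "y - x" m] by blast
      then show ?thesis using that(1) by simp
    qed
    show "x = y" if "x \<in> insert t L" "y \<in> insert t L" "x mod m = y mod m" for x y
      using *[OF _ that] *[OF _ that(2,1) that(3)[symmetric]] linear[of x y] by blast
  qed
  have img: "(\<lambda>x. x mod m) ` insert t L = S"
  proof (rule antisym)
    show "(\<lambda>x. x mod m) ` insert t L \<subseteq> S" using tS tm by (auto simp: L_def)
    show "S \<subseteq> (\<lambda>x. x mod m) ` insert t L"
    proof
      fix s assume s: "s \<in> S"
      then have sm: "s < m" using S by auto
      show "s \<in> (\<lambda>x. x mod m) ` insert t L"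
      proof (cases "s < t")
        case True
        then have "s + m \<in> L" using s sm tm by (auto simp: L_def)
        then show ?thesis using sm by (intro image_eqI[of _ _ "s + m"]) auto
      next
        case False
        then have "s \<in> insert t L" using s sm by (auto simp: L_def)
        then show ?thesis using sm by (intro image_eqI[of _ _ s]) auto
      qed
    qed
  qed
  have cS: "card S = Suc (card L)"
    using card_image[OF inj] img fL tL by simp
  \<comment> \<open>Elements without a link on the line are starts on the cycle. This gives a lower
    bound on the number of starts, which suffices because \<open>\<gamma> \<le> 1\<close>.\<close>
  have "(\<lambda>x. x mod m) ` insert t U \<subseteq> starts m r S"
  proof
    fix y assume "y \<in> (\<lambda>x. x mod m) ` insert t U"
    then obtain x where x: "x \<in> insert t U" "y = x mod m" by auto
    show "y \<in> starts m r S"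
    proof (cases "x = t")
      case True
      then show ?thesis using t tm x by auto
    next
      case False
      then have xL: "x \<in> L" and nolink: "\<And>a. a \<in> insert t L \<Longrightarrow> a < x \<Longrightarrow> x < a + r \<Longrightarrow> False"
        using x by (auto simp: U_def)
      have "(y + (m - g)) mod m \<notin> S" if g: "g \<in> {1..<r}" for g
      proof
        assume a: "(y + (m - g)) mod m \<in> S"
        have yx: "(y + (m - g)) mod m = (x + (m - g)) mod m"
          unfolding x(2) by (simp add: mod_add_left_eq)
        have gm: "g < m" using g r by auto
        show False
        proof (cases "t + g \<le> x")
          case True
          have "x + (m - g) = x - g + m" using True gm by simp
          then have "(x - g) mod m \<in> S" using a yx by simp
          then have "x - g \<in> insert t L" using True xL by (auto simp: L_def)
          moreover have "x - g < x" "x < x - g + r" using g True by auto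
          ultimately show False by (rule nolink)
        next
          case False
          \<comment> \<open>Here the step back by \<open>g\<close> passes \<open>t\<close>. It would
            end \<open>g' < r\<close> steps before \<open>t\<close>, where the start
            \<open>t\<close> allows no index of \<open>S\<close>.\<close>
          define g' where "g' = t + g - x"
          have tx: "t < x" using xL by (auto simp: L_def)
          have g': "g' \<in> {1..<r}" using False g tx by (auto simp: g'_def)
          have "x + (m - g) = t + (m - g')" using False gm tx by (auto simp: g'_def)
          then have "(t + (m - g')) mod m \<in> S" using a yx by simp
          then show False using t g' by (auto simp: starts_def)
        qed
      qed
      moreover have "y \<in> S" using xL x by (auto simp: L_def)
      ultimately show ?thesis by (auto simp: starts_def)
    qed
  qed
  then have "card ((\<lambda>x. x mod m) ` insert t U) \<le> card (starts m r S)"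
    by (intro card_mono finite_subset[OF starts_subset fS])
  moreover have "card ((\<lambda>x. x mod m) ` insert t U) = Suc (card U)"
  proof -
    have "inj_on (\<lambda>x. x mod m) (insert t U)" by (rule inj_on_subset[OF inj]) (auto simp: U_def)
    then show ?thesis using fL tL by (simp add: card_image U_def)
  qed
  ultimately have cU: "Suc (card U) \<le> card (starts m r S)" by simp
  have "(\<Prod>i\<in>L. link_weight r \<alpha> (\<alpha> * \<gamma>) ({t} \<union> L) i) = (\<Prod>i\<in>L. \<alpha> * (if i \<in> U then \<gamma> else 1))"
    by (intro prod.cong) (auto simp: link_weight_def U_def)
  also have "\<dots> = \<alpha> ^ card L * \<gamma> ^ card U"
  proof -
    have "(\<Prod>i\<in>L. if i \<in> U then \<gamma> else 1) = \<gamma> ^ card (L \<inter> U)"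
      using fL by (simp add: prod.If_cases)
    moreover have "L \<inter> U = U" by (auto simp: U_def)
    ultimately show ?thesis by (simp add: prod.distrib)
  qed
  finally have "\<alpha> * \<gamma> * (\<Prod>i\<in>L. link_weight r \<alpha> (\<alpha> * \<gamma>) ({t} \<union> L) i) = \<alpha> ^ card S * \<gamma> ^ Suc (card U)"
    unfolding cS by simp
  moreover have "\<alpha> ^ card S * \<gamma> ^ card (starts m r S) \<le> \<alpha> ^ card S * \<gamma> ^ Suc (card U)"
    using cU pos by (intro mult_left_mono power_decreasing) auto
  ultimately show ?thesis by (simp only:)
qed

text \<open>Given that \<open>t\<close> belongs to \<open>S\<close>, the unrolled set
  \<open>L S\<close> determines \<open>S\<close>. So the sum embeds into the one over all subsets of
  the \<open>m - 1\<close> numbers after \<open>t\<close>, with \<open>t\<close> as the only earlier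
  element. At most \<open>r\<close> numbers are in reach of \<open>t\<close>, which makes the
  potential at most 2.\<close>

lemma sum_weight_with_start_le:
  fixes \<alpha> \<gamma> :: real
  assumes t: "t < m" and r: "r \<le> m" and pos: "0 \<le> \<alpha>" "0 \<le> \<gamma>" "\<gamma> \<le> 1" and small: "2 * \<alpha> * real r \<le> 1"
  shows "(\<Sum>S | S \<subseteq> {..<m} \<and> t \<in> starts m r S. \<alpha> ^ card S * \<gamma> ^ card (starts m r S))
    \<le> 2 * (\<alpha> * \<gamma>) * (1 + 2 * (\<alpha> * \<gamma>)) ^ m"
proof -
  define \<beta> where "\<beta> = \<alpha> * \<gamma>"
  have \<beta>: "\<beta> \<ge> 0" using pos by (simp add: \<beta>_def)
  define L where "L = (\<lambda>S. {x \<in> {t+1..<t+m}. x mod m \<in> S})"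
  define W where "W = (\<lambda>L. \<Prod>i\<in>L. link_weight r \<alpha> \<beta> ({t} \<union> L) i)"
  define X where "X = {S. S \<subseteq> {..<m} \<and> t \<in> starts m r S}"
  have fX: "finite X" by (rule finite_subset[of _ "Pow {..<m}"]) (auto simp: X_def)
  have injL: "inj_on L X"
  proof (rule inj_onI)
    have *: "S \<subseteq> S'" if "S \<in> X" "S' \<in> X" "L S = L S'" for S S'
    proof
      fix s assume s: "s \<in> S"
      then have sm: "s < m" using that by (auto simp: X_def)
      consider "s = t" | "s > t" | "s < t" by linarith
      then show "s \<in> S'"
      proof cases
        case 1
        then show ?thesis using that(2) by (auto simp: X_def starts_def)
      next
        case 2
        then have "s \<in> L S" using s sm by (auto simp: L_def)
        then have "s \<in> L S'" using that(3) by simp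
        then show ?thesis using sm by (auto simp: L_def)
      next
        case 3
        then have "s + m \<in> L S" using s sm t by (auto simp: L_def)
        then have "s + m \<in> L S'" using that(3) by simp
        then show ?thesis using sm by (auto simp: L_def)
      qed
    qed
    show "S = S'" if "S \<in> X" "S' \<in> X" "L S = L S'" for S S'
      using *[OF that] *[OF that(2,1) that(3)[symmetric]] by blast
  qed
  have W0: "0 \<le> W L" for L unfolding W_def using pos \<beta> by (intro prod_nonneg) (auto simp: link_weight_def)
  have "(\<Sum>S\<in>X. \<alpha> ^ card S * \<gamma> ^ card (starts m r S)) \<le> (\<Sum>S\<in>X. \<beta> * W (L S))"
    unfolding W_def L_def \<beta>_def
    by (intro sum_mono weight_le_link_weights) (use r pos in \<open>auto simp: X_def\<close>)
  also have "\<dots> = \<beta> * (\<Sum>S\<in>L ` X. W S)"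
    unfolding sum.reindex[OF injL] sum_distrib_left by simp
  also have "\<dots> \<le> \<beta> * (\<Sum>S\<in>Pow {t+1..<t+1+(m-1)}. W S)"
    using t W0 \<beta> by (intro mult_left_mono sum_mono2) (auto simp: L_def)
  also have "\<dots> \<le> \<beta> * ((1 + 2 * \<beta>) ^ (m - 1) * (1 + 2 * \<alpha> * real (card {x. t + 1 \<le> x \<and> (\<exists>a\<in>{t}. x < a + r)})))"
    unfolding W_def using pos \<beta> small by (intro mult_left_mono sum_link_weight_le) auto
  also have "\<dots> \<le> \<beta> * ((1 + 2 * \<beta>) ^ m * 2)"
  proof (intro mult_left_mono mult_mono)
    have "{x. t + 1 \<le> x \<and> (\<exists>a\<in>{t}. x < a + r)} = {t+1..<t+r}" by auto
    then have "2 * \<alpha> * real (card {x. t + 1 \<le> x \<and> (\<exists>a\<in>{t}. x < a + r)}) \<le> 2 * \<alpha> * real r"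
      using pos by (intro mult_left_mono) auto
    then show "1 + 2 * \<alpha> * real (card {x. t + 1 \<le> x \<and> (\<exists>a\<in>{t}. x < a + r)}) \<le> 2" using small by linarith
    show "(1 + 2 * \<beta>) ^ (m - 1) \<le> (1 + 2 * \<beta>) ^ m" using \<beta> by (intro power_increasing) auto
  qed (use pos \<beta> in auto)
  finally show ?thesis unfolding X_def \<beta>_def by (simp add: mult_ac)
qed

text \<open>Here \<open>\<alpha>\<close> is the price of an edge and \<open>\<gamma>\<close> the
  extra price of a start. In the middle case the whole cycle is covered, which leaves one root with
  \<open>n\<close> choices and \<open>m\<close> covered vertices even if \<open>S\<close> has fewer
  than \<open>m\<close> elements.\<close>

definition cycle_weight :: "nat \<Rightarrow> nat \<Rightarrow> real \<Rightarrow> real \<Rightarrow> real \<Rightarrow> nat set \<Rightarrow> real" where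
  "cycle_weight m r n \<alpha> \<gamma> S =
     (if S = {} then 1 else if starts m r S = {} then n * \<alpha> ^ m
      else \<alpha> ^ card S * \<gamma> ^ card (starts m r S))"

lemma sum_cycle_weight_le:
  fixes \<alpha> \<gamma> n :: real
  assumes r: "r \<le> m" and pos: "0 \<le> \<alpha>" "0 \<le> \<gamma>" "\<gamma> \<le> 1" "0 \<le> n" and small: "2 * \<alpha> * real r \<le> 1"
  shows "(\<Sum>S\<in>Pow {..<m}. cycle_weight m r n \<alpha> \<gamma> S)
    \<le> 1 + n * (2 * \<alpha>) ^ m + 2 * real m * (\<alpha> * \<gamma>) * (1 + 2 * (\<alpha> * \<gamma>)) ^ m"
proof -
  define w where "w = (\<lambda>S. \<alpha> ^ card S * \<gamma> ^ card (starts m r S))"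
  have w0: "0 \<le> w S" for S using pos by (simp add: w_def)
  define X where "X = (\<lambda>t. {S. S \<subseteq> {..<m} \<and> t \<in> starts m r S})"
  have fX: "finite (X t)" for t by (rule finite_subset[of _ "Pow {..<m}"]) (auto simp: X_def)
  \<comment> \<open>A set with several starts is counted once for each of them. The term
    \<open>n * \<alpha> ^ m\<close> is charged to all \<open>2 ^ m\<close> sets, whether they have
    starts or not.\<close>
  have "cycle_weight m r n \<alpha> \<gamma> S \<le> (if S = {} then 1 else 0) + n * \<alpha> ^ m
      + (\<Sum>t<m. if S \<in> X t then w S else 0)" if S: "S \<in> Pow {..<m}" for S
  proof (cases "S = {} \<or> starts m r S = {}")
    case True
    have "0 \<le> (\<Sum>t<m. if S \<in> X t then w S else 0)" using w0 by (intro sum_nonneg) auto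
    moreover have "0 \<le> n * \<alpha> ^ m" using pos by simp
    ultimately show ?thesis using True by (auto simp: cycle_weight_def)
  next
    case False
    then obtain t where t: "t \<in> starts m r S" by auto
    have tm: "t < m" using t S by (auto simp: starts_def)
    have "w S = (if S \<in> X t then w S else 0)" using t S by (auto simp: X_def)
    also have "\<dots> \<le> (\<Sum>t<m. if S \<in> X t then w S else 0)"
      using tm w0 by (intro member_le_sum) auto
    finally show ?thesis using False pos by (simp add: cycle_weight_def w_def add_increasing)
  qed
  then have "(\<Sum>S\<in>Pow {..<m}. cycle_weight m r n \<alpha> \<gamma> S)
     \<le> (\<Sum>S\<in>Pow {..<m}. (if S = {} then 1 else 0) + n * \<alpha> ^ m + (\<Sum>t<m. if S \<in> X t then w S else 0))"
    by (intro sum_mono) auto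
  also have "\<dots> = (\<Sum>S\<in>Pow {..<m}. if S = {} then 1 else 0) + 2 ^ m * (n * \<alpha> ^ m)
       + (\<Sum>S\<in>Pow {..<m}. \<Sum>t<m. if S \<in> X t then w S else 0)"
    by (simp add: sum.distrib card_Pow)
  also have "(\<Sum>S\<in>Pow {..<m}. if S = {} then 1 else (0::real)) = 1"
    by simp
  also have "(\<Sum>S\<in>Pow {..<m}. \<Sum>t<m. if S \<in> X t then w S else 0) = (\<Sum>t<m. \<Sum>S\<in>X t. w S)"
  proof (subst sum.swap, rule sum.cong[OF refl])
    fix t
    have "Pow {..<m} \<inter> X t = X t" by (auto simp: X_def)
    then show "(\<Sum>S\<in>Pow {..<m}. if S \<in> X t then w S else 0) = (\<Sum>S\<in>X t. w S)"
      by (simp flip: sum.inter_restrict)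
  qed
  also have "(\<Sum>t<m. \<Sum>S\<in>X t. w S) \<le> (\<Sum>t<m. 2 * (\<alpha> * \<gamma>) * (1 + 2 * (\<alpha> * \<gamma>)) ^ m)"
    unfolding X_def w_def by (intro sum_mono sum_weight_with_start_le r pos small) auto
  also have "\<dots> = 2 * real m * (\<alpha> * \<gamma>) * (1 + 2 * (\<alpha> * \<gamma>)) ^ m" by simp
  finally show ?thesis by (simp add: power_mult_distrib mult_ac)
qed

text \<open>A map that matches the edges in \<open>S\<close> to given ordered edges is determined on the cover
  by the images of the positions in a set \<open>R\<close> with the following property.\<close>

definition spreads :: "nat \<Rightarrow> nat \<Rightarrow> nat set \<Rightarrow> nat set \<Rightarrow> bool" where
  "spreads m r S R \<longleftrightarrow>
     (\<forall>P. (\<forall>i\<in>S. \<forall>x\<in>edge_positions m r i. \<forall>y\<in>edge_positions m r i. P x \<longrightarrow> P y) \<longrightarrow>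
       (\<forall>x\<in>R. P x) \<longrightarrow> (\<forall>x\<in>cover m r S. P x))"

lemma spreadsD:
  assumes "spreads m r S R" "z \<in> cover m r S"
    and "\<And>i x y. i \<in> S \<Longrightarrow> x \<in> edge_positions m r i \<Longrightarrow> y \<in> edge_positions m r i \<Longrightarrow> P x \<Longrightarrow> P y"
    and "\<And>x. x \<in> R \<Longrightarrow> P x"
  shows "P z"
proof -
  have *: "(\<forall>i\<in>S. \<forall>x\<in>edge_positions m r i. \<forall>y\<in>edge_positions m r i. P x \<longrightarrow> P y) \<longrightarrow>
       (\<forall>x\<in>R. P x) \<longrightarrow> (\<forall>x\<in>cover m r S. P x)"
    using assms(1) unfolding spreads_def by (rule spec)
  have "\<forall>i\<in>S. \<forall>x\<in>edge_positions m r i. \<forall>y\<in>edge_positions m r i. P x \<longrightarrow> P y"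
    using assms(3) by (intro ballI impI)
  moreover have "\<forall>x\<in>R. P x" using assms(4) by (intro ballI)
  ultimately have "\<forall>x\<in>cover m r S. P x" using * by (elim impE)
  then show ?thesis using assms(2) by (rule bspec)
qed

text \<open>The root of the edge \<open>t\<close> makes the criterion apply also to edges that close
  up around the cycle; otherwise \<open>t\<close> can be one of the starts.\<close>

lemma spreads_if_starts:
  assumes S: "S \<subseteq> {..<m}" and r: "1 \<le> r" "r \<le> m"
    and t: "t \<in> S" "(t + 1) mod m \<in> R" and st: "\<And>i. i \<in> starts m r S \<Longrightarrow> (i + 1) mod m \<in> R"
  shows "spreads m r S R"
  unfolding spreads_def
proof (intro allI impI ballI)
  fix P z
  assume P: "\<forall>i\<in>S. \<forall>x\<in>edge_positions m r i. \<forall>y\<in>edge_positions m r i. P x \<longrightarrow> P y"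
    and R: "\<forall>x\<in>R. P x" and z: "z \<in> cover m r S"
  show "P z"
  proof (rule cover_propagate[where P = P, OF S r _ t(1) bspec[OF R t(2)] bspec[OF R st] z])
    show "P y" if "i \<in> S" "x \<in> edge_positions m r i" "y \<in> edge_positions m r i" "P x" for i x y
      using P[rule_format, OF that] .
  qed
qed

text \<open>Roots are the first positions of the starts, or that of an arbitrary edge if there is no
  start. The left side anticipates the count: \<open>n\<close> images for each root, a factor
  \<open>b\<close> for each covered vertex, and a factor \<open>K\<close> for the orders and the
  weight of each edge.\<close>

lemma exists_roots:
  fixes n b K :: real
  assumes S: "S \<subseteq> {..<m}" and r: "1 \<le> r" "r \<le> m" and n: "1 \<le> n" and b: "0 < b" "b \<le> 1" and K: "1 \<le> K"
  shows "\<exists>R. R \<subseteq> cover m r S \<and> spreads m r S R \<and>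
    n ^ card R * b ^ card (cover m r S) * K ^ card S \<le> cycle_weight m r n (b * K) (n * b ^ (r - 1)) S"
proof (cases "S = {}")
  case True
  then show ?thesis by (intro exI[of _ "{}"]) (simp add: cover_def cycle_weight_def spreads_def)
next
  case False
  have fS: "finite S" using S finite_subset by auto
  have first: "(i + 1) mod m \<in> cover m r S" if "i \<in> S" for i
    unfolding cover_def by (rule UN_I[OF that edge_positionsI]) (use r in simp)
  show ?thesis
  proof (cases "starts m r S = {}")
    case True
    obtain t where t: "t \<in> S" using False by auto
    have cov: "cover m r S = {..<m}" using cover_eq_if_no_starts[OF S False r(2) True] .
    have "card S \<le> m" using card_mono[OF _ S] by simp
    then have "K ^ card S \<le> K ^ m" using K by (intro power_increasing)
    then have "n * b ^ m * K ^ card S \<le> n * b ^ m * K ^ m" using n b by (intro mult_left_mono) auto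
    then have "n ^ card {(t + 1) mod m} * b ^ card (cover m r S) * K ^ card S
        \<le> cycle_weight m r n (b * K) (n * b ^ (r - 1)) S"
      unfolding cycle_weight_def if_not_P[OF False] if_P[OF True] cov power_mult_distrib
      by (simp add: mult.assoc)
    moreover have "spreads m r S {(t + 1) mod m}"
      by (rule spreads_if_starts[OF S r t]) (use True in simp_all)
    moreover have "{(t + 1) mod m} \<subseteq> cover m r S" using first[OF t] by simp
    ultimately show ?thesis by (intro exI[of _ "{(t + 1) mod m}"] conjI)
  next
    case T: False
    then obtain t where t: "t \<in> starts m r S" by auto
    define R where "R = (\<lambda>i. (i + 1) mod m) ` starts m r S"
    have fT: "finite (starts m r S)" by (rule finite_subset[OF starts_subset fS])
    have cR: "card R \<le> card (starts m r S)" unfolding R_def by (rule card_image_le[OF fT])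
    have "n ^ card R \<le> n ^ card (starts m r S)" using cR n by (rule power_increasing)
    \<comment> \<open>As \<open>b \<le> 1\<close>, the lower bound on the cover becomes an upper
      bound: one factor \<open>b\<close> for every edge and \<open>r - 1\<close> more for every
      start.\<close>
    moreover have "b ^ card (cover m r S) \<le> b ^ (card S + (r - 1) * card (starts m r S))"
      using card_cover_ge[OF S r] b by (intro power_decreasing) simp_all
    ultimately have "n ^ card R * b ^ card (cover m r S) * K ^ card S
       \<le> n ^ card (starts m r S) * b ^ (card S + (r - 1) * card (starts m r S)) * K ^ card S"
      using n b K by (intro mult_right_mono mult_mono) simp_all
    also have "\<dots> = cycle_weight m r n (b * K) (n * b ^ (r - 1)) S"
      unfolding cycle_weight_def if_not_P[OF False] if_not_P[OF T] power_mult_distrib power_add power_mult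
      by (simp only: mult_ac)
    finally have "n ^ card R * b ^ card (cover m r S) * K ^ card S
       \<le> cycle_weight m r n (b * K) (n * b ^ (r - 1)) S" .
    moreover have "spreads m r S R"
      by (rule spreads_if_starts[OF S r subsetD[OF starts_subset t]]) (use t in \<open>simp_all add: R_def\<close>)
    moreover have "R \<subseteq> cover m r S"
      unfolding R_def by (rule image_subsetI, rule first, erule subsetD[OF starts_subset])
    ultimately show ?thesis by (intro exI[of _ R] conjI)
  qed
qed

subsection \<open>Counting permutations that match prescribed edges\<close>

text \<open>Prescribing \<open>v\<close> values leaves \<open>(n - v)!\<close> permutations; the
  lemma turns this into a factor \<open>exp 1 / n\<close> per value. In the induction, changing the
  base from \<open>k + 1\<close> to \<open>k\<close> in a power \<open>w \<le> k\<close> costs at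
  most \<open>(1 + 1 / k) ^ k \<le> exp 1\<close>.\<close>

lemma power_times_fact_le:
  assumes "v \<le> n"
  shows "real n ^ v * fact (n - v) \<le> exp 1 ^ v * fact n"
  using assms
proof (induction n arbitrary: v)
  case 0
  then show ?case by simp
next
  case (Suc k)
  show ?case
  proof (cases v)
    case 0
    then show ?thesis by simp
  next
    case (Suc w)
    have wk: "w \<le> k" using Suc Suc.prems by simp
    have *: "(real k + 1) ^ w \<le> exp 1 * real k ^ w"
    proof (cases "k = 0")
      case True
      then show ?thesis using wk by simp
    next
      case False
      have "(1 + 1 / real k) ^ w \<le> exp (1 / real k) ^ w"
        by (intro power_mono) auto
      also have "\<dots> = exp (real w / real k)" by (simp add: exp_of_nat_mult[symmetric])
      also have "\<dots> \<le> exp 1" using wk False by simp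
      finally have "(1 + 1 / real k) ^ w * real k ^ w \<le> exp 1 * real k ^ w"
        by (intro mult_right_mono) auto
      moreover have "(1 + 1 / real k) * real k = real k + 1" using False by (simp add: field_simps)
      ultimately show ?thesis by (simp flip: power_mult_distrib)
    qed
    have "real (Suc k) ^ Suc w * fact (Suc k - Suc w) = real (Suc k) * ((real k + 1) ^ w * fact (k - w))"
      by (simp add: add_ac)
    also have "\<dots> \<le> real (Suc k) * (exp 1 * real k ^ w * fact (k - w))"
      using * by (intro mult_left_mono mult_right_mono) auto
    also have "\<dots> = real (Suc k) * exp 1 * (real k ^ w * fact (k - w))" by simp
    also have "\<dots> \<le> real (Suc k) * exp 1 * (exp 1 ^ w * fact k)"
      using wk by (intro mult_left_mono Suc.IH) auto
    also have "\<dots> = exp 1 ^ Suc w * fact (Suc k)" by simp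
    finally show ?thesis unfolding Suc .
  qed
qed

text \<open>Group the permutations by their restriction to \<open>R\<close>. Within a group they all
  agree on \<open>U\<close>, so they differ from a fixed member only by a permutation of
  \<open>V - U\<close>.\<close>

lemma card_permutations_determined_le:
  assumes V: "finite V" and RU: "R \<subseteq> U" "U \<subseteq> V" and M: "M \<subseteq> {\<sigma>. \<sigma> permutes V}"
    and det: "\<And>\<sigma> \<tau> u. \<sigma> \<in> M \<Longrightarrow> \<tau> \<in> M \<Longrightarrow> (\<And>x. x \<in> R \<Longrightarrow> \<sigma> x = \<tau> x) \<Longrightarrow> u \<in> U \<Longrightarrow> \<sigma> u = \<tau> u"
  shows "card M \<le> card V ^ card R * fact (card V - card U)"
proof -
  define fibre where "fibre = (\<lambda>\<rho>. {\<sigma> \<in> M. \<forall>x\<in>R. \<sigma> x = \<rho> x})"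
  have fR: "finite R" using V RU finite_subset by metis
  have fU: "finite U" using V RU finite_subset by metis
  have fM: "finite M" using M finite_permutations[OF V] finite_subset by metis
  have fib: "card (fibre \<rho>) \<le> fact (card V - card U)" for \<rho>
  proof (cases "fibre \<rho> = {}")
    case True
    then show ?thesis by simp
  next
    case False
    then obtain \<sigma>\<^sub>0 where \<sigma>\<^sub>0: "\<sigma>\<^sub>0 \<in> fibre \<rho>" by auto
    then have p0: "\<sigma>\<^sub>0 permutes V" using M by (auto simp: fibre_def)
    have "(\<lambda>\<sigma>. inv \<sigma>\<^sub>0 \<circ> \<sigma>) ` fibre \<rho> \<subseteq> {\<pi>. \<pi> permutes (V - U)}"
    proof clarify
      fix \<sigma> assume s: "\<sigma> \<in> fibre \<rho>"
      then have p: "\<sigma> permutes V" using M by (auto simp: fibre_def)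
      have agree: "\<sigma> u = \<sigma>\<^sub>0 u" if "u \<in> U" for u
        by (rule det[OF _ _ _ that]) (use s \<sigma>\<^sub>0 in \<open>auto simp: fibre_def\<close>)
      show "inv \<sigma>\<^sub>0 \<circ> \<sigma> permutes (V - U)"
      proof (rule permutes_superset)
        show "inv \<sigma>\<^sub>0 \<circ> \<sigma> permutes V" using p p0 by (intro permutes_compose permutes_inv)
        show "(inv \<sigma>\<^sub>0 \<circ> \<sigma>) x = x" if "x \<in> V - (V - U)" for x
          using that agree[of x] permutes_inverses[OF p0] by auto
      qed
    qed
    moreover have "inj_on (\<lambda>\<sigma>. inv \<sigma>\<^sub>0 \<circ> \<sigma>) (fibre \<rho>)"
    proof (rule inj_onI)
      fix \<sigma> \<tau> :: "'a \<Rightarrow> 'a" assume "inv \<sigma>\<^sub>0 \<circ> \<sigma> = inv \<sigma>\<^sub>0 \<circ> \<tau>"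
      then have "\<sigma>\<^sub>0 \<circ> (inv \<sigma>\<^sub>0 \<circ> \<sigma>) = \<sigma>\<^sub>0 \<circ> (inv \<sigma>\<^sub>0 \<circ> \<tau>)" by simp
      then show "\<sigma> = \<tau>" using permutes_inv_o[OF p0] by (simp add: o_assoc)
    qed
    ultimately have "card (fibre \<rho>) \<le> card {\<pi>. \<pi> permutes (V - U)}"
      using V by (intro card_inj_on_le) (auto intro: finite_permutations)
    also have "\<dots> = fact (card V - card U)"
      using V fU RU by (subst card_permutations[OF refl]) (auto simp: card_Diff_subset)
    finally show ?thesis .
  qed
  have "M \<subseteq> (\<Union>\<rho>\<in>R \<rightarrow>\<^sub>E V. fibre \<rho>)"
  proof
    fix \<sigma> assume s: "\<sigma> \<in> M"
    then have "\<sigma> permutes V" using M by auto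
    then have "restrict \<sigma> R \<in> R \<rightarrow>\<^sub>E V" using RU permutes_in_image by fastforce
    moreover have "\<sigma> \<in> fibre (restrict \<sigma> R)" using s by (auto simp: fibre_def)
    ultimately show "\<sigma> \<in> (\<Union>\<rho>\<in>R \<rightarrow>\<^sub>E V. fibre \<rho>)" by blast
  qed
  then have "card M \<le> card (\<Union>\<rho>\<in>R \<rightarrow>\<^sub>E V. fibre \<rho>)"
    using fM V fR by (intro card_mono) (auto simp: fibre_def intro!: finite_PiE)
  also have "\<dots> \<le> (\<Sum>\<rho>\<in>R \<rightarrow>\<^sub>E V. card (fibre \<rho>))"
    using V fR by (intro card_UN_le finite_PiE) auto
  also have "\<dots> \<le> (\<Sum>\<rho>\<in>R \<rightarrow>\<^sub>E V. fact (card V - card U))" by (intro sum_mono fib)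
  also have "\<dots> = card V ^ card R * fact (card V - card U)"
    using fR by (simp add: card_PiE)
  finally show ?thesis .
qed

text \<open>The vertex at position \<open>i\<close> of the \<open>c\<close>-th cycle is \<open>x c i\<close>.\<close>

definition cycle_edge :: "nat \<Rightarrow> (nat \<Rightarrow> nat) \<Rightarrow> (nat \<Rightarrow> nat \<Rightarrow> 'a) \<Rightarrow> nat \<Rightarrow> nat \<Rightarrow> 'a set" where
  "cycle_edge r m x c i = x c ` edge_positions (m c) r i"

definition cycle_edges :: "nat \<Rightarrow> nat \<Rightarrow> (nat \<Rightarrow> nat) \<Rightarrow> (nat \<Rightarrow> nat \<Rightarrow> 'a) \<Rightarrow> 'a set set" where
  "cycle_edges r l m x = {cycle_edge r m x c i | c i. c < l \<and> i < m c}"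

text \<open>The edges of \<open>x\<close> are moved by permutations and tested for membership in the
  edges of \<open>y\<close>. In the second moment, \<open>y\<close> is itself an image of
  \<open>x\<close> under a permutation.\<close>

locale cycle_arrangements =
  fixes r l :: nat and m :: "nat \<Rightarrow> nat" and V :: "'a set" and x y :: "nat \<Rightarrow> nat \<Rightarrow> 'a"
  assumes r1: "1 \<le> r" and rm: "\<And>c. c < l \<Longrightarrow> r \<le> m c"
    and finV: "finite V"
    and xV: "\<And>c i. c < l \<Longrightarrow> i < m c \<Longrightarrow> x c i \<in> V"
    and injx: "\<And>c i c' i'. c < l \<Longrightarrow> i < m c \<Longrightarrow> c' < l \<Longrightarrow> i' < m c' \<Longrightarrow> x c i = x c' i' \<Longrightarrow> c = c' \<and> i = i'"
    and injy: "\<And>c i c' i'. c < l \<Longrightarrow> i < m c \<Longrightarrow> c' < l \<Longrightarrow> i' < m c' \<Longrightarrow> y c i = y c' i' \<Longrightarrow> c = c' \<and> i = i'"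
begin

definition matching :: "(nat \<Rightarrow> nat set) \<Rightarrow> ('a \<Rightarrow> 'a) set" where
  "matching g = {\<sigma>. \<sigma> permutes V \<and> (\<forall>c<l. \<forall>i\<in>g c. \<sigma> ` cycle_edge r m x c i \<in> cycle_edges r l m y)}"

text \<open>Here \<open>\<pi>\<close> prescribes how the vertices of every matched edge are permuted; then the image of
  an edge is determined by the image of any one of its vertices.\<close>

definition ordered_matching ::
    "(nat \<Rightarrow> nat set) \<Rightarrow> ((nat \<times> nat) \<times> nat \<Rightarrow> nat) \<Rightarrow> ('a \<Rightarrow> 'a) set" where
  "ordered_matching g \<pi> = {\<sigma>. \<sigma> permutes V \<and> (\<forall>c<l. \<forall>i\<in>g c. \<exists>c'<l. \<exists>i'<m c'.
     \<forall>a\<in>{1..r}. \<sigma> (x c ((i + a) mod m c)) = y c' ((i' + \<pi> ((c, i), a)) mod m c'))}"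

text \<open>For each matched edge choose an edge of \<open>y\<close> that it is sent to, and for
  each of its \<open>r\<close> offsets the offset of the image. Recording only the offsets leaves
  \<open>r ^ r\<close> possibilities per edge.\<close>

lemma matching_subset_ordered:
  fixes g :: "nat \<Rightarrow> nat set"
  defines "A \<equiv> SIGMA c:{..<l}. g c"
  shows "matching g \<subseteq> (\<Union>\<pi>\<in>(A \<times> {1..r}) \<rightarrow>\<^sub>E {1..r}. ordered_matching g \<pi>)"
proof
  fix \<sigma> assume s: "\<sigma> \<in> matching g"
  have "\<forall>p\<in>A. \<exists>q. fst q < l \<and> snd q < m (fst q) \<and>
      \<sigma> ` cycle_edge r m x (fst p) (snd p) = cycle_edge r m y (fst q) (snd q)"
  proof
    fix p assume "p \<in> A"
    then have "\<sigma> ` cycle_edge r m x (fst p) (snd p) \<in> cycle_edges r l m y"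
      using s by (auto simp: matching_def A_def)
    then obtain c i where "c < l" "i < m c" "\<sigma> ` cycle_edge r m x (fst p) (snd p) = cycle_edge r m y c i"
      unfolding cycle_edges_def by blast
    then show "\<exists>q. fst q < l \<and> snd q < m (fst q) \<and>
      \<sigma> ` cycle_edge r m x (fst p) (snd p) = cycle_edge r m y (fst q) (snd q)"
      by (intro exI[of _ "(c, i)"]) simp
  qed
  from bchoice[OF this] obtain q where q: "\<And>p. p \<in> A \<Longrightarrow> fst (q p) < l \<and> snd (q p) < m (fst (q p)) \<and>
      \<sigma> ` cycle_edge r m x (fst p) (snd p) = cycle_edge r m y (fst (q p)) (snd (q p))"
    by blast
  define img where "img = (\<lambda>(p, a) b. \<sigma> (x (fst p) ((snd p + a) mod m (fst p)))
      = y (fst (q p)) ((snd (q p) + b) mod m (fst (q p))))"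
  have "\<forall>z\<in>A \<times> {1..r}. \<exists>b. b \<in> {1..r} \<and> img z b"
  proof clarify
    fix c i a assume p: "(c, i) \<in> A" and a: "a \<in> {1..r}"
    have "\<sigma> (x c ((i + a) mod m c)) \<in> \<sigma> ` cycle_edge r m x c i"
      unfolding cycle_edge_def by (rule imageI, rule imageI, rule edge_positionsI, rule a)
    also have "\<dots> = cycle_edge r m y (fst (q (c, i))) (snd (q (c, i)))" using q[OF p] by simp
    finally obtain b where "b \<in> {1..r}"
      "\<sigma> (x c ((i + a) mod m c)) = y (fst (q (c, i))) ((snd (q (c, i)) + b) mod m (fst (q (c, i))))"
      unfolding cycle_edge_def edge_positions_def by (elim imageE) simp
    then show "\<exists>b. b \<in> {1..r} \<and> img ((c, i), a) b"
      by (intro exI[of _ b]) (simp add: img_def)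
  qed
  from bchoice[OF this] obtain b where "\<forall>z\<in>A \<times> {1..r}. b z \<in> {1..r} \<and> img z (b z)"
    by (rule exE)
  then have b: "b z \<in> {1..r} \<and> img z (b z)" if "z \<in> A \<times> {1..r}" for z
    using that by (rule bspec)
  have "restrict b (A \<times> {1..r}) \<in> (A \<times> {1..r}) \<rightarrow>\<^sub>E {1..r}" using b by (simp only: restrict_PiE_iff, intro ballI) simp
  moreover have "\<sigma> \<in> ordered_matching g (restrict b (A \<times> {1..r}))"
  proof -
    have "\<exists>c'<l. \<exists>i'<m c'. \<forall>a\<in>{1..r}. \<sigma> (x c ((i + a) mod m c))
        = y c' ((i' + restrict b (A \<times> {1..r}) ((c, i), a)) mod m c')" if "c < l" "i \<in> g c" for c i
    proof -
      have A: "(c, i) \<in> A" using that by (simp add: A_def)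
      show ?thesis
      proof (intro exI conjI ballI)
        show "fst (q (c, i)) < l" "snd (q (c, i)) < m (fst (q (c, i)))" using q[OF A] by auto
        show "\<sigma> (x c ((i + a) mod m c)) = y (fst (q (c, i)))
          ((snd (q (c, i)) + restrict b (A \<times> {1..r}) ((c, i), a)) mod m (fst (q (c, i))))"
          if "a \<in> {1..r}" for a
          using b[of "((c, i), a)"] A that by (simp add: img_def)
      qed
    qed
    then show ?thesis using s by (auto simp: ordered_matching_def matching_def)
  qed
  ultimately show "\<sigma> \<in> (\<Union>\<pi>\<in>(A \<times> {1..r}) \<rightarrow>\<^sub>E {1..r}. ordered_matching g \<pi>)" by blast
qed

text \<open>With the orders fixed, two permutations that agree at one vertex of a matched edge agree
  on all of it, since \<open>y\<close> is injective. Agreement at the roots therefore spreads over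
  the cover, and the permutations are determined there by their values at the roots.\<close>

lemma card_ordered_matching_le:
  assumes g: "\<And>c. c < l \<Longrightarrow> g c \<subseteq> {..<m c}"
    and R: "\<And>c. c < l \<Longrightarrow> R c \<subseteq> cover (m c) r (g c)"
    and spr: "\<And>c. c < l \<Longrightarrow> spreads (m c) r (g c) (R c)"
  shows "real (card (ordered_matching g \<pi>)) * real (card V) ^ (\<Sum>c<l. card (cover (m c) r (g c)))
    \<le> real (card V) ^ (\<Sum>c<l. card (R c)) * exp 1 ^ (\<Sum>c<l. card (cover (m c) r (g c))) * fact (card V)"
proof -
  define U' where "U' = (\<Union>c\<in>{..<l}. x c ` cover (m c) r (g c))"
  define R' where "R' = (\<Union>c\<in>{..<l}. x c ` R c)"
  have mpos: "0 < m c" if "c < l" for c using rm[OF that] r1 by simp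
  have cov: "cover (m c) r (g c) \<subseteq> {..<m c}" if "c < l" for c using cover_subset[OF mpos[OF that]] .
  have fcov: "finite (cover (m c) r (g c))" if "c < l" for c using cov[OF that] finite_subset by blast
  have RU: "R' \<subseteq> U'" using R by (fastforce simp: R'_def U'_def)
  have UV: "U' \<subseteq> V" using cov xV by (fastforce simp: U'_def)
  have cardU: "card U' = (\<Sum>c<l. card (cover (m c) r (g c)))"
  proof -
    have "card U' = (\<Sum>c<l. card (x c ` cover (m c) r (g c)))"
      unfolding U'_def
    proof (rule card_UN_disjoint)
      show "\<forall>c\<in>{..<l}. finite (x c ` cover (m c) r (g c))" using fcov by auto
      show "\<forall>c\<in>{..<l}. \<forall>d\<in>{..<l}. c \<noteq> d \<longrightarrow> x c ` cover (m c) r (g c) \<inter> x d ` cover (m d) r (g d) = {}"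
      proof (intro ballI impI equals0I)
        fix c d z assume "c \<in> {..<l}" "d \<in> {..<l}" "c \<noteq> d"
          "z \<in> x c ` cover (m c) r (g c) \<inter> x d ` cover (m d) r (g d)"
        then obtain i j where cd: "c < l" "d < l" "c \<noteq> d" and "x c i = x d j"
          and ij: "i \<in> cover (m c) r (g c)" "j \<in> cover (m d) r (g d)"
          by auto
        moreover have "i < m c" "j < m d" using cov[OF cd(1)] cov[OF cd(2)] ij by auto
        ultimately show False using injx by blast
      qed
    qed simp
    also have "\<dots> = (\<Sum>c<l. card (cover (m c) r (g c)))"
    proof (intro sum.cong refl card_image inj_onI)
      fix c z w assume "c \<in> {..<l}" "z \<in> cover (m c) r (g c)" "w \<in> cover (m c) r (g c)" "x c z = x c w"
      then show "z = w" using injx[of c z c w] cov[of c] by auto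
    qed
    finally show ?thesis .
  qed
  have cardR: "card R' \<le> (\<Sum>c<l. card (R c))"
  proof -
    have "card R' \<le> (\<Sum>c<l. card (x c ` R c))" unfolding R'_def by (rule card_UN_le) simp
    also have "\<dots> \<le> (\<Sum>c<l. card (R c))"
      using R fcov by (intro sum_mono card_image_le) (meson finite_subset lessThan_iff)
    finally show ?thesis .
  qed
  have "card (ordered_matching g \<pi>) \<le> card V ^ card R' * fact (card V - card U')"
  proof (rule card_permutations_determined_le[OF finV RU UV])
    show "ordered_matching g \<pi> \<subseteq> {\<sigma>. \<sigma> permutes V}" by (auto simp: ordered_matching_def)
    fix \<sigma> \<tau> u assume \<sigma>: "\<sigma> \<in> ordered_matching g \<pi>" and \<tau>: "\<tau> \<in> ordered_matching g \<pi>"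
      and eqR: "\<And>x. x \<in> R' \<Longrightarrow> \<sigma> x = \<tau> x" and u: "u \<in> U'"
    obtain c z where c: "c < l" and z: "z \<in> cover (m c) r (g c)" and [simp]: "u = x c z"
      using u by (auto simp: U'_def)
    have "\<sigma> (x c z) = \<tau> (x c z)"
    proof (rule spreadsD[OF spr[OF c] z, where P = "\<lambda>z. \<sigma> (x c z) = \<tau> (x c z)"])
      show "\<sigma> (x c z) = \<tau> (x c z)" if "z \<in> R c" for z using that c eqR by (auto simp: R'_def)
      fix i z w assume i: "i \<in> g c" and z: "z \<in> edge_positions (m c) r i"
        and w: "w \<in> edge_positions (m c) r i" and eq: "\<sigma> (x c z) = \<tau> (x c z)"
      obtain a where a: "a \<in> {1..r}" "z = (i + a) mod m c" using z by (auto simp: edge_positions_def)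
      obtain b where b: "b \<in> {1..r}" "w = (i + b) mod m c" using w by (auto simp: edge_positions_def)
      obtain c\<^sub>1 i\<^sub>1 where 1: "c\<^sub>1 < l" "i\<^sub>1 < m c\<^sub>1"
        "\<forall>a\<in>{1..r}. \<sigma> (x c ((i + a) mod m c)) = y c\<^sub>1 ((i\<^sub>1 + \<pi> ((c, i), a)) mod m c\<^sub>1)"
        using \<sigma> c i unfolding ordered_matching_def by blast
      obtain c\<^sub>2 i\<^sub>2 where 2: "c\<^sub>2 < l" "i\<^sub>2 < m c\<^sub>2"
        "\<forall>a\<in>{1..r}. \<tau> (x c ((i + a) mod m c)) = y c\<^sub>2 ((i\<^sub>2 + \<pi> ((c, i), a)) mod m c\<^sub>2)"
        using \<tau> c i unfolding ordered_matching_def by blast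
      \<comment> \<open>Both images have the same offset \<open>\<pi> ((c, i), a)\<close> in their
        edges, so equal images force equal edges with equal labelling.\<close>
      have "y c\<^sub>1 ((i\<^sub>1 + \<pi> ((c, i), a)) mod m c\<^sub>1) = y c\<^sub>2 ((i\<^sub>2 + \<pi> ((c, i), a)) mod m c\<^sub>2)"
        using eq 1 2 a by auto
      then have cc: "c\<^sub>1 = c\<^sub>2" and "(i\<^sub>1 + \<pi> ((c, i), a)) mod m c\<^sub>1 = (i\<^sub>2 + \<pi> ((c, i), a)) mod m c\<^sub>2"
        using injy[OF 1(1) mod_less_divisor[OF mpos[OF 1(1)]] 2(1) mod_less_divisor[OF mpos[OF 2(1)]]] by auto
      then have "i\<^sub>1 mod m c\<^sub>1 = i\<^sub>2 mod m c\<^sub>1"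
        using mod_add_left_cancel_nat[of "\<pi> ((c, i), a)" i\<^sub>1 "m c\<^sub>1" i\<^sub>2] by (simp add: add.commute)
      then have "i\<^sub>1 = i\<^sub>2" using 1 2 cc by simp
      then show "\<sigma> (x c w) = \<tau> (x c w)" using 1 2 cc b by simp
    qed
    then show "\<sigma> u = \<tau> u" by simp
  qed
  then have "real (card (ordered_matching g \<pi>)) \<le> real (card V ^ card R' * fact (card V - card U'))"
    by (simp only: of_nat_le_iff)
  then have "real (card (ordered_matching g \<pi>)) * real (card V) ^ card U'
      \<le> real (card V) ^ card R' * fact (card V - card U') * real (card V) ^ card U'"
    by (intro mult_right_mono) auto
  also have "\<dots> = real (card V) ^ card R' * (real (card V) ^ card U' * fact (card V - card U'))"
    by simp
  also have "\<dots> \<le> real (card V) ^ (\<Sum>c<l. card (R c)) * (exp 1 ^ card U' * fact (card V))"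
  proof (rule mult_mono)
    show "real (card V) ^ card U' * fact (card V - card U') \<le> exp 1 ^ card U' * fact (card V)"
      using UV finV by (intro power_times_fact_le card_mono)
    show "real (card V) ^ card R' \<le> real (card V) ^ (\<Sum>c<l. card (R c))"
    \<comment> \<open>Raising the exponent requires a base of at least 1. For empty \<open>V\<close>
      there are no roots, and both exponents are 0.\<close>
    proof (cases "V = {}")
      case True
      then have "x c ` cover (m c) r (g c) = {}" if "c < l" for c using that UV by (auto simp: U'_def)
      then have "R c = {}" if "c < l" for c using R[OF that] that by auto
      then show ?thesis by (simp add: R'_def)
    next
      case False
      then have "card V \<ge> 1" using finV by (simp add: Suc_leI card_gt_0_iff)
      then show ?thesis using cardR by (intro power_increasing) auto
    qed
  qed auto
  finally show ?thesis unfolding cardU by (simp add: mult_ac)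
qed

text \<open>Each chosen edge brings \<open>r ^ r\<close> orders and a factor \<open>Q\<close>, both
  absorbed in \<open>K\<close>. The rest is a product over the cycles, and each cycle is bounded
  through its own roots. \<open>card V \<ge> 3\<close> ensures \<open>b \<le> 1\<close>.\<close>

lemma card_matching_le:
  fixes Q :: real
  assumes g: "\<And>c. c < l \<Longrightarrow> g c \<subseteq> {..<m c}" and V3: "card V \<ge> 3" and Q: "Q \<ge> 1"
  defines "n \<equiv> real (card V)"
  defines "b \<equiv> exp 1 / n"
  shows "Q ^ (\<Sum>c<l. card (g c)) * real (card (matching g))
    \<le> fact (card V) * (\<Prod>c<l. cycle_weight (m c) r n (b * (real (r ^ r) * Q)) (n * b ^ (r - 1)) (g c))"
proof -
  define K where "K = real (r ^ r) * Q"
  have n: "n \<ge> 3" using V3 by (simp add: n_def)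
  have b: "0 < b" "b \<le> 1" using n exp_le by (auto simp: b_def)
  have "1 \<le> real (r ^ r)" using r1 by (simp add: Suc_le_eq)
  then have K: "K \<ge> 1" using Q mult_mono[of 1 "real (r ^ r)" 1 Q] by (simp add: K_def)
  have "\<exists>R. R \<subseteq> cover (m c) r (g c) \<and> spreads (m c) r (g c) R \<and>
      n ^ card R * b ^ card (cover (m c) r (g c)) * K ^ card (g c)
      \<le> cycle_weight (m c) r n (b * K) (n * b ^ (r - 1)) (g c)" if c: "c < l" for c
    by (rule exists_roots[OF g[OF c] r1 rm[OF c] _ b K]) (use n in simp)
  then obtain R where R_subset: "\<And>c. c < l \<Longrightarrow> R c \<subseteq> cover (m c) r (g c)"
    and R_spreads: "\<And>c. c < l \<Longrightarrow> spreads (m c) r (g c) (R c)"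
    and R_weight: "\<And>c. c < l \<Longrightarrow> n ^ card (R c) * b ^ card (cover (m c) r (g c)) * K ^ card (g c)
      \<le> cycle_weight (m c) r n (b * K) (n * b ^ (r - 1)) (g c)"
    by metis
  define A where "A = (SIGMA c:{..<l}. g c)"
  have fg: "finite (g c)" if "c < l" for c using g[OF that] finite_subset by blast
  have fA: "finite A" unfolding A_def using fg by auto
  have cA: "card A = (\<Sum>c<l. card (g c))" unfolding A_def using fg by simp
  define \<Theta> where "\<Theta> = (A \<times> {1..r}) \<rightarrow>\<^sub>E {1..r}"
  have f\<Theta>: "finite \<Theta>" unfolding \<Theta>_def using fA by (intro finite_PiE) auto
  have c\<Theta>: "card \<Theta> = (r ^ r) ^ card A"
    unfolding \<Theta>_def using fA by (simp add: card_PiE card_cartesian_product power_mult mult.commute)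
  define u where "u = (\<Sum>c<l. card (cover (m c) r (g c)))"
  define \<rho> where "\<rho> = (\<Sum>c<l. card (R c))"
  have om: "real (card (ordered_matching g \<pi>)) \<le> n ^ \<rho> * b ^ u * fact (card V)" for \<pi>
  proof -
    have "real (card (ordered_matching g \<pi>)) * n ^ u \<le> n ^ \<rho> * exp 1 ^ u * fact (card V)"
      unfolding n_def u_def \<rho>_def
      by (rule card_ordered_matching_le[OF g R_subset R_spreads])
    then have "real (card (ordered_matching g \<pi>)) \<le> n ^ \<rho> * exp 1 ^ u * fact (card V) / n ^ u"
      using n by (subst pos_le_divide_eq) auto
    then show ?thesis by (simp add: b_def power_divide)
  qed
  have "finite {\<sigma>. \<sigma> permutes V}" by (rule finite_permutations[OF finV])
  then have fo: "finite (ordered_matching g \<pi>)" for \<pi>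
    by (rule finite_subset[rotated]) (auto simp: ordered_matching_def)
  have "card (matching g) \<le> card (\<Union>\<pi>\<in>\<Theta>. ordered_matching g \<pi>)"
    using matching_subset_ordered[of g] fo f\<Theta> unfolding \<Theta>_def A_def by (intro card_mono) auto
  also have "\<dots> \<le> (\<Sum>\<pi>\<in>\<Theta>. card (ordered_matching g \<pi>))" using f\<Theta> by (rule card_UN_le)
  finally have "real (card (matching g)) \<le> (\<Sum>\<pi>\<in>\<Theta>. real (card (ordered_matching g \<pi>)))"
    by (simp flip: of_nat_sum)
  also have "\<dots> \<le> (\<Sum>\<pi>\<in>\<Theta>. n ^ \<rho> * b ^ u * fact (card V))" by (intro sum_mono om)
  also have "\<dots> = real (r ^ r) ^ card A * (n ^ \<rho> * b ^ u * fact (card V))" using c\<Theta> by simp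
  finally have "Q ^ card A * real (card (matching g))
      \<le> Q ^ card A * (real (r ^ r) ^ card A * (n ^ \<rho> * b ^ u * fact (card V)))"
    using Q by (intro mult_left_mono) auto
  also have "\<dots> = fact (card V) * (n ^ \<rho> * b ^ u * K ^ card A)"
    unfolding K_def power_mult_distrib by (simp add: mult_ac)
  also have "n ^ \<rho> * b ^ u * K ^ card A
     = (\<Prod>c<l. n ^ card (R c) * b ^ card (cover (m c) r (g c)) * K ^ card (g c))"
    unfolding \<rho>_def u_def cA by (simp add: power_sum prod.distrib)
  also have "fact (card V) * \<dots> \<le> fact (card V) * (\<Prod>c<l. cycle_weight (m c) r n (b * K) (n * b ^ (r - 1)) (g c))"
    using R_weight n b K by (intro mult_left_mono prod_mono conjI) auto
  finally show ?thesis unfolding cA K_def .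
qed

text \<open>Expanding a product of factors \<open>1 + Q\<close> over the edges that land in the
  target gives a sum over sets \<open>g\<close> of edges. After exchanging the sums, the inner one
  counts the permutations that match all of \<open>g\<close>; its bound is a product over the
  cycles, so the sum over \<open>g\<close> factorises.\<close>

lemma sum_permutations_overlap_le:
  fixes Q :: real
  assumes V3: "card V \<ge> 3" and Q: "Q \<ge> 1"
  defines "n \<equiv> real (card V)"
  defines "b \<equiv> exp 1 / n"
  shows "(\<Sum>\<sigma> | \<sigma> permutes V. (1 + Q) ^ card ((`) \<sigma> ` cycle_edges r l m x \<inter> cycle_edges r l m y))
    \<le> fact (card V) * (\<Prod>c<l. \<Sum>S\<in>Pow {..<m c}.
         cycle_weight (m c) r n (b * (real (r ^ r) * Q)) (n * b ^ (r - 1)) S)"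
proof -
  define e where "e = (\<lambda>\<sigma> c i. if \<sigma> ` cycle_edge r m x c i \<in> cycle_edges r l m y then Q else 0)"
  define G where "G = PiE {..<l} (\<lambda>c. Pow {..<m c})"
  define W where "W = (\<lambda>c S. cycle_weight (m c) r n (b * (real (r ^ r) * Q)) (n * b ^ (r - 1)) S)"
  have fperm: "finite {\<sigma>. \<sigma> permutes V}" by (rule finite_permutations[OF finV])
  have one: "(1 + Q) ^ card ((`) \<sigma> ` cycle_edges r l m x \<inter> cycle_edges r l m y)
     \<le> (\<Sum>g\<in>G. \<Prod>c<l. \<Prod>i\<in>g c. e \<sigma> c i)" for \<sigma> :: "'a \<Rightarrow> 'a"
  proof -
    define I where "I = (SIGMA c:{..<l}. {..<m c})"
    define J where "J = {p\<in>I. \<sigma> ` cycle_edge r m x (fst p) (snd p) \<in> cycle_edges r l m y}"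
    have fI: "finite I" by (simp add: I_def)
    have "(`) \<sigma> ` cycle_edges r l m x \<inter> cycle_edges r l m y
        \<subseteq> (\<lambda>p. \<sigma> ` cycle_edge r m x (fst p) (snd p)) ` J"
    proof
      fix E assume E: "E \<in> (`) \<sigma> ` cycle_edges r l m x \<inter> cycle_edges r l m y"
      then obtain c i where ci: "c < l" "i < m c" "E = \<sigma> ` cycle_edge r m x c i"
        unfolding cycle_edges_def by blast
      then have "(c, i) \<in> J" using E by (auto simp: J_def I_def)
      then show "E \<in> (\<lambda>p. \<sigma> ` cycle_edge r m x (fst p) (snd p)) ` J" using ci by force
    qed
    \<comment> \<open>Different indices may name the same edge, as when \<open>m c = r\<close>,
      hence only an inequality.\<close>
    then have "card ((`) \<sigma> ` cycle_edges r l m x \<inter> cycle_edges r l m y) \<le> card J"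
      using fI by (intro surj_card_le) (auto simp: J_def)
    then have "(1 + Q) ^ card ((`) \<sigma> ` cycle_edges r l m x \<inter> cycle_edges r l m y) \<le> (1 + Q) ^ card J"
      using Q by (intro power_increasing) auto
    also have "(1 + Q) ^ card J = (\<Prod>p\<in>I. if p \<in> J then 1 + Q else 1)"
    proof -
      have "I \<inter> J = J" by (auto simp: J_def)
      then show ?thesis using fI by (simp add: prod.If_cases)
    qed
    also have "\<dots> = (\<Prod>p\<in>I. e \<sigma> (fst p) (snd p) + 1)"
      by (intro prod.cong) (auto simp: J_def e_def)
    also have "\<dots> = (\<Prod>c<l. \<Prod>i<m c. e \<sigma> c i + 1)"
      unfolding I_def by (subst prod.Sigma) (auto simp: case_prod_beta)
    also have "\<dots> = (\<Prod>c<l. \<Sum>S\<in>Pow {..<m c}. \<Prod>i\<in>S. e \<sigma> c i)"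
      by (simp add: prod_add)
    also have "\<dots> = (\<Sum>g\<in>G. \<Prod>c<l. \<Prod>i\<in>g c. e \<sigma> c i)"
      unfolding G_def by (subst prod_sum_PiE) auto
    finally show ?thesis .
  qed
  have "(\<Sum>\<sigma> | \<sigma> permutes V. (1 + Q) ^ card ((`) \<sigma> ` cycle_edges r l m x \<inter> cycle_edges r l m y))
      \<le> (\<Sum>\<sigma> | \<sigma> permutes V. \<Sum>g\<in>G. \<Prod>c<l. \<Prod>i\<in>g c. e \<sigma> c i)"
    by (intro sum_mono one)
  also have "\<dots> = (\<Sum>g\<in>G. \<Sum>\<sigma> | \<sigma> permutes V. \<Prod>c<l. \<Prod>i\<in>g c. e \<sigma> c i)"
    by (rule sum.swap)
  also have "\<dots> \<le> (\<Sum>g\<in>G. fact (card V) * (\<Prod>c<l. W c (g c)))"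
  proof (rule sum_mono)
    fix g assume g: "g \<in> G"
    have gc: "g c \<subseteq> {..<m c}" if "c < l" for c using g that by (auto simp: G_def PiE_iff)
    \<comment> \<open>A single chosen edge that misses the target makes the product vanish.\<close>
    have "(\<Prod>c<l. \<Prod>i\<in>g c. e \<sigma> c i) = (if \<sigma> \<in> matching g then Q ^ (\<Sum>c<l. card (g c)) else 0)"
      if perm: "\<sigma> permutes V" for \<sigma>
    proof (cases "\<sigma> \<in> matching g")
      case True
      then have "(\<Prod>c<l. \<Prod>i\<in>g c. e \<sigma> c i) = (\<Prod>c<l. \<Prod>i\<in>g c. Q)"
        by (intro prod.cong) (auto simp: e_def matching_def)
      then show ?thesis using True by (simp add: power_sum)
    next
      case False
      then obtain c i where c: "c < l" and i: "i \<in> g c" and "e \<sigma> c i = 0"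
        using perm by (auto simp: e_def matching_def)
      moreover have "finite (g c)" using gc[OF c] finite_subset by blast
      ultimately have "(\<Prod>i\<in>g c. e \<sigma> c i) = 0" by (intro prod_zero) auto
      then have "(\<Prod>c<l. \<Prod>i\<in>g c. e \<sigma> c i) = 0" using c by (intro prod_zero) auto
      then show ?thesis using False by simp
    qed
    then have "(\<Sum>\<sigma> | \<sigma> permutes V. \<Prod>c<l. \<Prod>i\<in>g c. e \<sigma> c i)
       = (\<Sum>\<sigma> | \<sigma> permutes V. if \<sigma> \<in> matching g then Q ^ (\<Sum>c<l. card (g c)) else 0)"
      by (intro sum.cong) auto
    also have "\<dots> = (\<Sum>\<sigma>\<in>{\<sigma>. \<sigma> permutes V} \<inter> matching g. Q ^ (\<Sum>c<l. card (g c)))"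
      using fperm by (rule sum.inter_restrict[symmetric])
    also have "{\<sigma>. \<sigma> permutes V} \<inter> matching g = matching g" by (auto simp: matching_def)
    also have "(\<Sum>\<sigma>\<in>matching g. Q ^ (\<Sum>c<l. card (g c))) = Q ^ (\<Sum>c<l. card (g c)) * real (card (matching g))"
      by simp
    also have "\<dots> \<le> fact (card V) * (\<Prod>c<l. W c (g c))"
      unfolding W_def n_def b_def using gc V3 Q by (rule card_matching_le)
    finally show "(\<Sum>\<sigma> | \<sigma> permutes V. \<Prod>c<l. \<Prod>i\<in>g c. e \<sigma> c i) \<le> fact (card V) * (\<Prod>c<l. W c (g c))" .
  qed
  also have "\<dots> = fact (card V) * (\<Prod>c<l. \<Sum>S\<in>Pow {..<m c}. W c S)"
    unfolding G_def by (subst prod_sum_PiE) (auto simp: sum_distrib_left)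
  finally show ?thesis unfolding W_def .
qed

end

subsection \<open>The second moment method\<close>

text \<open>Let \<open>X\<close> count the indices whose set is contained in the random one. The
  hypotheses give mean \<open>\<mu> = a * card I\<close> and variance at most
  \<open>h * \<mu>\<^sup>2\<close>, and Chebyshev's inequality bounds the probability of
  \<open>X = 0\<close>.\<close>

lemma prob_exists_subset_ge:
  fixes M :: "'b set pmf" and A :: "'i \<Rightarrow> 'b set" and a h :: real
  assumes fin: "finite (set_pmf M)" and I: "finite I" "I \<noteq> {}" and a: "a > 0"
    and first: "\<And>i. i \<in> I \<Longrightarrow> measure_pmf.prob M {E. A i \<subseteq> E} = a"
    and second: "\<And>j. j \<in> I \<Longrightarrow> (\<Sum>i\<in>I. measure_pmf.prob M {E. A i \<union> A j \<subseteq> E}) \<le> a\<^sup>2 * card I * (1 + h)"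
  shows "measure_pmf.prob M {E. \<exists>i\<in>I. A i \<subseteq> E} \<ge> 1 - h"
proof -
  define X where "X = (\<lambda>E. \<Sum>i\<in>I. indicator {E. A i \<subseteq> E} E :: real)"
  define \<mu> where "\<mu> = a * card I"
  have int: "integrable (measure_pmf M) f" for f :: "'b set \<Rightarrow> real"
    by (rule integrable_measure_pmf_finite[OF fin])
  have \<mu>: "\<mu> > 0" using a I by (simp add: \<mu>_def card_gt_0_iff)
  have EX: "measure_pmf.expectation M X = \<mu>"
    unfolding X_def by (subst Bochner_Integration.integral_sum) (auto simp: int first \<mu>_def)
  have "(X E)\<^sup>2 = (\<Sum>j\<in>I. \<Sum>i\<in>I. indicator {E. A i \<union> A j \<subseteq> E} E)" for E
    unfolding X_def power2_eq_square sum_product by (subst sum.swap) (auto intro!: sum.cong simp: indicator_def)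
  then have "measure_pmf.expectation M (\<lambda>E. (X E)\<^sup>2)
      = measure_pmf.expectation M (\<lambda>E. \<Sum>j\<in>I. \<Sum>i\<in>I. indicator {E. A i \<union> A j \<subseteq> E} E)"
    by simp
  also have "\<dots> = (\<Sum>j\<in>I. \<Sum>i\<in>I. measure_pmf.prob M {E. A i \<union> A j \<subseteq> E})"
    by (subst Bochner_Integration.integral_sum, rule int, rule sum.cong[OF refl],
        subst Bochner_Integration.integral_sum, rule int) simp
  also have "\<dots> \<le> (\<Sum>j\<in>I. a\<^sup>2 * card I * (1 + h))" by (intro sum_mono second)
  also have "\<dots> = \<mu>\<^sup>2 * (1 + h)" by (simp add: \<mu>_def power2_eq_square)
  finally have EX2: "measure_pmf.expectation M (\<lambda>E. (X E)\<^sup>2) \<le> \<mu>\<^sup>2 * (1 + h)" .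
  \<comment> \<open>Chebyshev's inequality by hand: where no set is contained, \<open>X\<close>
    deviates from its mean by exactly \<open>\<mu>\<close>.\<close>
  have "measure_pmf.expectation M (\<lambda>E. indicator {E. \<not> (\<exists>i\<in>I. A i \<subseteq> E)} E * \<mu>\<^sup>2)
      \<le> measure_pmf.expectation M (\<lambda>E. (X E - \<mu>)\<^sup>2)"
  proof (rule integral_mono[OF int int])
    fix E
    show "indicator {E. \<not> (\<exists>i\<in>I. A i \<subseteq> E)} E * \<mu>\<^sup>2 \<le> (X E - \<mu>)\<^sup>2"
    proof (cases "\<exists>i\<in>I. A i \<subseteq> E")
      case True
      then show ?thesis by simp
    next
      case False
      then have "X E = 0" by (auto simp: X_def)
      then show ?thesis using False by simp
    qed
  qed
  also have "measure_pmf.expectation M (\<lambda>E. (X E - \<mu>)\<^sup>2)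
      = measure_pmf.expectation M (\<lambda>E. (X E)\<^sup>2 - 2 * \<mu> * X E + \<mu>\<^sup>2)"
    by (simp add: power2_diff algebra_simps)
  also have "\<dots> = measure_pmf.expectation M (\<lambda>E. (X E)\<^sup>2) - 2 * \<mu> * \<mu> + \<mu>\<^sup>2"
    by (simp add: int EX)
  also have "\<dots> \<le> h * \<mu>\<^sup>2" using EX2 by (simp add: power2_eq_square algebra_simps)
  finally have "measure_pmf.prob M {E. \<not> (\<exists>i\<in>I. A i \<subseteq> E)} * \<mu>\<^sup>2 \<le> h * \<mu>\<^sup>2"
    by simp
  then have "measure_pmf.prob M {E. \<not> (\<exists>i\<in>I. A i \<subseteq> E)} \<le> h" using \<mu> by simp
  moreover have "measure_pmf.prob M {E. \<not> (\<exists>i\<in>I. A i \<subseteq> E)} = 1 - measure_pmf.prob M {E. \<exists>i\<in>I. A i \<subseteq> E}"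
    using measure_pmf.prob_compl[of "{E. \<exists>i\<in>I. A i \<subseteq> E}" M]
    unfolding Collect_neg_eq Compl_eq_Diff_UNIV by simp
  ultimately show ?thesis by linarith
qed

section \<open>Copies of the cycles in the random hypergraph\<close>

lemma finite_r_subsets: "finite V \<Longrightarrow> finite (r_subsets r V)"
  by (rule finite_subset[of _ "Pow V"]) (auto simp: r_subsets_def)

lemma finite_set_pmf_random_hypergraph: "finite (set_pmf (random_hypergraph r n p))"
  by (rule finite_subset[of _ "Pow (r_subsets r {1..n})"])
     (auto simp: random_hypergraph_def finite_r_subsets)

lemma prob_subset_random_hypergraph:
  assumes F: "F \<subseteq> r_subsets r {1..n}" and p: "0 \<le> p" "p \<le> 1"
  shows "measure_pmf.prob (random_hypergraph r n p) {E. F \<subseteq> E} = p ^ card F"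
proof -
  define K where "K = r_subsets r {1..n}"
  have fK: "finite K" unfolding K_def by (rule finite_r_subsets) simp
  define B where "B = (\<lambda>e. if e \<in> F then {True} else UNIV)"
  \<comment> \<open>The event prescribes the indicators of the edges in \<open>F\<close> and leaves
    the others free, so it is a product set and independence applies.\<close>
  have "(\<lambda>f. {e \<in> K. f e}) -` {E. F \<subseteq> E} = Pi K B"
  proof (intro set_eqI iffI)
    fix f assume "f \<in> Pi K B"
    then have "f e" if "e \<in> F" for e using that F by (auto simp: K_def B_def dest: Pi_mem[of f _ _ e])
    then show "f \<in> (\<lambda>f. {e \<in> K. f e}) -` {E. F \<subseteq> E}" using F by (auto simp: K_def)
  qed (auto simp: B_def)
  then have "measure_pmf.prob (random_hypergraph r n p) {E. F \<subseteq> E}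
     = measure_pmf.prob (Pi_pmf K False (\<lambda>_. bernoulli_pmf p)) (Pi K B)"
    unfolding random_hypergraph_def K_def[symmetric] measure_map_pmf by simp
  also have "\<dots> = (\<Prod>e\<in>K. if e \<in> F then p else 1)"
    unfolding measure_Pi_pmf_Pi[OF fK] using p
    by (intro prod.cong) (auto simp: B_def measure_pmf_single)
  also have "\<dots> = p ^ card (K \<inter> F)" using fK by (simp add: prod.If_cases)
  also have "K \<inter> F = F" using F by (auto simp: K_def)
  finally show ?thesis .
qed

lemma card_image_edges:
  assumes "\<sigma> permutes V"
  shows "card ((`) \<sigma> ` F) = card F"
  by (rule card_image) (use permutes_inj[OF assms] in \<open>auto intro!: inj_onI simp: inj_image_eq_iff\<close>)

lemma has_disjoint_tight_cyclesI:
  assumes sub: "cycle_edges r (length ms) (\<lambda>c. ms ! c) y \<subseteq> E"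
    and ms: "\<forall>m\<in>set ms. 0 < m"
    and yV: "\<And>c i. c < length ms \<Longrightarrow> i < ms ! c \<Longrightarrow> y c i \<in> V"
    and inj: "\<And>c i c' i'. c < length ms \<Longrightarrow> i < ms ! c \<Longrightarrow> c' < length ms \<Longrightarrow> i' < ms ! c' \<Longrightarrow>
      y c i = y c' i' \<Longrightarrow> c = c' \<and> i = i'"
  shows "has_disjoint_tight_cycles r V E ms"
  unfolding has_disjoint_tight_cycles_def
proof (intro exI conjI allI impI)
  define Cs where "Cs = map (\<lambda>c. map (y c) [0..<ms ! c]) [0..<length ms]"
  show "length Cs = length ms" by (simp add: Cs_def)
  fix c assume c: "c < length ms"
  have Cc: "Cs ! c = map (y c) [0..<ms ! c]" using c by (simp add: Cs_def)
  show "length (Cs ! c) = ms ! c" by (simp add: Cc)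
  show "tight_cycle r V E (Cs ! c)"
    unfolding tight_cycle_def
  proof (intro conjI allI impI)
    have pos: "0 < ms ! c" using ms c by simp
    then show "Cs ! c \<noteq> []" by (simp add: Cc)
    show "distinct (Cs ! c)"
      unfolding Cc distinct_map using inj[OF c _ c] by (auto intro!: inj_onI)
    show "set (Cs ! c) \<subseteq> V" using yV[OF c] by (auto simp: Cc)
    fix i assume i: "i < length (Cs ! c)"
    have "(\<lambda>j. Cs ! c ! ((i + j) mod length (Cs ! c))) ` {1..r} = cycle_edge r (\<lambda>c. ms ! c) y c i"
      using pos by (simp add: Cc cycle_edge_def edge_positions_def image_image)
    also have "\<dots> \<in> E" using sub c i by (auto simp: cycle_edges_def Cc)
    finally show "(\<lambda>j. Cs ! c ! ((i + j) mod length (Cs ! c))) ` {1..r} \<in> E" .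
  qed
next
  fix c d assume c: "c < length ms" and d: "d < length ms" and cd: "c \<noteq> d"
  show "set (map (\<lambda>c. map (y c) [0..<ms ! c]) [0..<length ms] ! c) \<inter>
      set (map (\<lambda>c. map (y c) [0..<ms ! c]) [0..<length ms] ! d) = {}"
    using c d cd inj[OF c _ d] by auto
qed

text \<open>The second moment bound is applied to the images \<open>A \<sigma>\<close> of one fixed
  arrangement under all permutations. Two images with \<open>e\<close> edges each and
  \<open>k\<close> common ones occur together with probability \<open>p ^ (2 * e - k)\<close>, so
  the average of \<open>(1 + Q) ^ k\<close> controls the second moment.\<close>

lemma prob_disjoint_tight_cycles_ge:
  fixes p Q :: real
  assumes r: "1 \<le> r" and n: "3 \<le> n" and ms: "\<And>m. m \<in> set ms \<Longrightarrow> r \<le> m" and sum: "sum_list ms \<le> n"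
    and p: "0 < p" "p \<le> 1" and Q: "1 \<le> Q" "1 / p \<le> 1 + Q"
  shows "measure_pmf.prob (random_hypergraph r n p) {E. has_disjoint_tight_cycles r {1..n} E ms}
    \<ge> 2 - (\<Prod>c<length ms. \<Sum>S\<in>Pow {..<ms ! c}.
        cycle_weight (ms ! c) r n (exp 1 / n * (real (r ^ r) * Q)) (n * (exp 1 / n) ^ (r - 1)) S)"
    (is "_ \<ge> 2 - ?B")
proof -
  define l where "l = length ms"
  define m where "m = (\<lambda>c. ms ! c)"
  define V where "V = {1..n}"
  have rm: "r \<le> m c" if "c < l" for c using ms[of "ms ! c"] that by (simp add: m_def l_def)
  have "card (SIGMA c:{..<l}. {..<m c}) = (\<Sum>c<l. m c)" by simp
  also have "\<dots> = sum_list ms" by (simp add: sum_list_sum_nth l_def m_def atLeast0LessThan)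
  finally have "card (SIGMA c:{..<l}. {..<m c}) \<le> card V" using sum by (simp add: V_def)
  \<comment> \<open>As the lengths sum to at most \<open>n\<close>, all cycles fit disjointly into
    the vertex set.\<close>
  then obtain f where f: "f ` (SIGMA c:{..<l}. {..<m c}) \<subseteq> V" "inj_on f (SIGMA c:{..<l}. {..<m c})"
    using card_le_inj[of "SIGMA c:{..<l}. {..<m c}" V] by (auto simp: V_def)
  define x where "x = (\<lambda>c i. f (c, i))"
  have xV: "x c i \<in> V" if "c < l" "i < m c" for c i using f(1) that by (force simp: x_def)
  have injx: "c = c' \<and> i = i'" if "c < l" "i < m c" "c' < l" "i' < m c'" "x c i = x c' i'" for c i c' i'
    using inj_onD[OF f(2), of "(c, i)" "(c', i')"] that by (auto simp: x_def)
  define F where "F = cycle_edges r l m x"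
  define e where "e = card F"
  define A where "A = (\<lambda>\<sigma> :: nat \<Rightarrow> nat. (`) \<sigma> ` F)"
  define I where "I = {\<sigma>. \<sigma> permutes V}"
  have fI: "finite I" unfolding I_def by (rule finite_permutations) (simp add: V_def)
  have cI: "card I = fact n" unfolding I_def by (rule card_permutations) (simp_all add: V_def)
  have A_eq: "A \<sigma> = cycle_edges r l m (\<lambda>c i. \<sigma> (x c i))" for \<sigma>
  proof -
    have "\<sigma> ` cycle_edge r m x c i = cycle_edge r m (\<lambda>c i. \<sigma> (x c i)) c i" for c i
      by (simp add: cycle_edge_def image_image)
    then show ?thesis unfolding A_def F_def cycle_edges_def by blast
  qed
  have Ak: "A \<sigma> \<subseteq> r_subsets r V" if "\<sigma> \<in> I" for \<sigma>
  proof
    fix E assume "E \<in> A \<sigma>"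
    then obtain c i where c: "c < l" and i: "i < m c" and E: "E = (\<lambda>i. \<sigma> (x c i)) ` edge_positions (m c) r i"
      by (auto simp: A_eq cycle_edges_def cycle_edge_def)
    have pos: "edge_positions (m c) r i \<subseteq> {..<m c}" using i by (auto simp: edge_positions_def)
    have \<sigma>: "\<sigma> permutes V" using that by (simp add: I_def)
    have "inj_on (\<lambda>j. (i + j) mod m c) {1..r}"
    proof (rule inj_onI)
      fix a b assume ab: "a \<in> {1..r}" "b \<in> {1..r}" "(i + a) mod m c = (i + b) mod m c"
      have "a mod m c = b mod m c" using ab(3) by (rule mod_add_left_cancel_nat)
      moreover have "a \<le> m c" "b \<le> m c" using ab rm[OF c] by auto
      \<comment> \<open>Offsets from 1 to \<open>m c\<close> have distinct residues; only
        \<open>m c\<close> itself is reduced, to 0.\<close>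
      ultimately show "a = b" using ab by (cases "a = m c"; cases "b = m c") auto
    qed
    then have "card (edge_positions (m c) r i) = r" unfolding edge_positions_def by (simp add: card_image)
    moreover have "inj_on (\<lambda>i. \<sigma> (x c i)) (edge_positions (m c) r i)"
    proof (rule inj_onI)
      fix a b assume "a \<in> edge_positions (m c) r i" "b \<in> edge_positions (m c) r i" "\<sigma> (x c a) = \<sigma> (x c b)"
      then show "a = b" using pos injx[OF c _ c] injD[OF permutes_inj[OF \<sigma>]] by blast
    qed
    ultimately have "card E = r" unfolding E by (simp add: card_image)
    moreover have "E \<subseteq> V" unfolding E using pos xV[OF c] permutes_in_image[OF \<sigma>] by auto
    ultimately show "E \<in> r_subsets r V" by (simp add: r_subsets_def)
  qed
  have cA: "card (A \<sigma>) = e" if "\<sigma> \<in> I" for \<sigma>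
    using that card_image_edges by (auto simp: A_def e_def I_def)
  have fA: "finite (A \<sigma>)" if "\<sigma> \<in> I" for \<sigma>
    using Ak[OF that] finite_r_subsets[of V] by (auto simp: V_def intro: finite_subset)
  have "measure_pmf.prob (random_hypergraph r n p) {E. \<exists>\<sigma>\<in>I. A \<sigma> \<subseteq> E} \<ge> 1 - (?B - 1)"
  proof (rule prob_exists_subset_ge[OF finite_set_pmf_random_hypergraph fI])
    show "I \<noteq> {}" using cI by auto
    show "p ^ e > 0" using p by simp
    show "measure_pmf.prob (random_hypergraph r n p) {E. A \<sigma> \<subseteq> E} = p ^ e" if "\<sigma> \<in> I" for \<sigma>
      using prob_subset_random_hypergraph[of "A \<sigma>" r n p] Ak[OF that] cA[OF that] p by (simp add: V_def)
    fix \<tau> assume \<tau>: "\<tau> \<in> I"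
    \<comment> \<open>Each image in turn is the target; the resulting bound does not depend on
      \<open>\<tau>\<close>.\<close>
    interpret cycle_arrangements r l m V x "\<lambda>c i. \<tau> (x c i)"
    proof
      show "1 \<le> r" by fact
      show "r \<le> m c" if "c < l" for c using rm[OF that] .
      show "finite V" by (simp add: V_def)
      show "x c i \<in> V" if "c < l" "i < m c" for c i using xV that .
      show "c = c' \<and> i = i'" if "c < l" "i < m c" "c' < l" "i' < m c'" "x c i = x c' i'" for c i c' i'
        using injx that .
      show "c = c' \<and> i = i'" if "c < l" "i < m c" "c' < l" "i' < m c'" "\<tau> (x c i) = \<tau> (x c' i')" for c i c' i'
        using that \<tau> by (intro injx) (auto simp: I_def dest: injD[OF permutes_inj])
    qed
    have "(\<Sum>\<sigma>\<in>I. measure_pmf.prob (random_hypergraph r n p) {E. A \<sigma> \<union> A \<tau> \<subseteq> E})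
      \<le> (\<Sum>\<sigma>\<in>I. (p ^ e)\<^sup>2 * (1 + Q) ^ card (A \<sigma> \<inter> A \<tau>))"
    proof (rule sum_mono)
      fix \<sigma> assume \<sigma>: "\<sigma> \<in> I"
      have "card (A \<sigma> \<union> A \<tau>) + card (A \<sigma> \<inter> A \<tau>) = e + e"
        using card_Un_Int[OF fA[OF \<sigma>] fA[OF \<tau>]] cA[OF \<sigma>] cA[OF \<tau>] by simp
      then have "p ^ card (A \<sigma> \<union> A \<tau>) * p ^ card (A \<sigma> \<inter> A \<tau>) = (p ^ e)\<^sup>2"
        by (simp add: power_add[symmetric] power2_eq_square)
      then have "p ^ card (A \<sigma> \<union> A \<tau>) = (p ^ e)\<^sup>2 * (1 / p) ^ card (A \<sigma> \<inter> A \<tau>)"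
        using p by (simp add: field_simps)
      also have "\<dots> \<le> (p ^ e)\<^sup>2 * (1 + Q) ^ card (A \<sigma> \<inter> A \<tau>)"
        using p Q by (intro mult_left_mono power_mono) auto
      finally show "measure_pmf.prob (random_hypergraph r n p) {E. A \<sigma> \<union> A \<tau> \<subseteq> E}
        \<le> (p ^ e)\<^sup>2 * (1 + Q) ^ card (A \<sigma> \<inter> A \<tau>)"
        using prob_subset_random_hypergraph[of "A \<sigma> \<union> A \<tau>" r n p] Ak[OF \<sigma>] Ak[OF \<tau>] p
        by (simp add: V_def)
    qed
    also have "\<dots> = (p ^ e)\<^sup>2 * (\<Sum>\<sigma>\<in>I. (1 + Q) ^ card (A \<sigma> \<inter> A \<tau>))"
      by (simp add: sum_distrib_left)
    also have "(\<Sum>\<sigma>\<in>I. (1 + Q) ^ card (A \<sigma> \<inter> A \<tau>)) \<le> fact n * ?B"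
      using sum_permutations_overlap_le[of Q] n Q
      unfolding I_def A_eq[of \<tau>] unfolding A_def F_def V_def m_def l_def by simp
    finally show "(\<Sum>\<sigma>\<in>I. measure_pmf.prob (random_hypergraph r n p) {E. A \<sigma> \<union> A \<tau> \<subseteq> E})
      \<le> (p ^ e)\<^sup>2 * real (card I) * (1 + (?B - 1))"
      using p by (simp add: cI mult_left_mono mult.assoc)
  qed
  also have "\<dots> \<le> measure_pmf.prob (random_hypergraph r n p) {E. has_disjoint_tight_cycles r {1..n} E ms}"
  proof (rule measure_pmf.finite_measure_mono)
    show "{E. \<exists>\<sigma>\<in>I. A \<sigma> \<subseteq> E} \<subseteq> {E. has_disjoint_tight_cycles r {1..n} E ms}"
    proof clarify
      fix E \<sigma> assume \<sigma>: "\<sigma> \<in> I" and sub: "A \<sigma> \<subseteq> E"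
      then have perm: "\<sigma> permutes V" by (simp add: I_def)
      show "has_disjoint_tight_cycles r {1..n} E ms"
      proof (rule has_disjoint_tight_cyclesI)
        show "cycle_edges r (length ms) (\<lambda>c. ms ! c) (\<lambda>c i. \<sigma> (x c i)) \<subseteq> E"
          using sub by (simp add: A_eq l_def m_def)
        show "\<forall>m\<in>set ms. 0 < m" using ms r by fastforce
        show "\<sigma> (x c i) \<in> {1..n}" if "c < length ms" "i < ms ! c" for c i
          using xV that permutes_in_image[OF perm] by (simp add: l_def m_def V_def)
        show "c = c' \<and> i = i'" if "c < length ms" "i < ms ! c" "c' < length ms" "i' < ms ! c'"
          "\<sigma> (x c i) = \<sigma> (x c' i')" for c i c' i'
          using that injD[OF permutes_inj[OF perm]] injx[of c i c' i'] by (simp add: l_def m_def)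
      qed
    qed
  qed simp
  finally show ?thesis by simp
qed

subsection \<open>Asymptotics\<close>

text \<open>A cycle of length \<open>m\<close> contributes a factor of at most
  \<open>1 + m * c \<le> exp (m * c)\<close>. Since the lengths sum to at most \<open>n\<close>, the
  product is at most \<open>exp (n * c)\<close>, however many cycles there are.\<close>

lemma prob_disjoint_tight_cycles_ge_exp:
  fixes p \<epsilon> :: real
  assumes r: "3 \<le> r" and \<epsilon>: "0 < \<epsilon>" "\<epsilon> < 1"
    and ms: "\<And>m. m \<in> set ms \<Longrightarrow> real m \<ge> 2 * real r / \<epsilon>" and sum: "sum_list ms \<le> n"
    and p: "real n powr (-1 + \<epsilon>) < p" "p \<le> 1"
  defines "\<alpha> \<equiv> exp 1 * real (r ^ r) * real n powr -\<epsilon>"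
  assumes n: "real n \<ge> (exp 1)\<^sup>2" and small: "2 * \<alpha> * real r \<le> 1" "2 * \<alpha> * (exp 1)\<^sup>2 \<le> 1"
    "2 * \<alpha> \<le> real n powr (-\<epsilon>/2)"
  shows "measure_pmf.prob (random_hypergraph r n p) {E. has_disjoint_tight_cycles r {1..n} E ms}
    \<ge> 2 - exp (1 / real n + 6 * (exp 1)\<^sup>2 * \<alpha>)"
proof -
  define \<gamma> where "\<gamma> = real n * (exp 1 / real n) ^ (r - 1)"
  \<comment> \<open>The lower bound on \<open>p\<close> makes \<open>1 / p\<close> smaller than this
    \<open>Q\<close>, and the price of an edge becomes \<open>\<alpha>\<close>.\<close>
  define Q where "Q = real n powr (1 - \<epsilon>)"
  have e2: "(2::real) \<le> exp 1" using exp_ge_add_one_self[of 1] by simp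
  have "(2::real)\<^sup>2 \<le> (exp 1)\<^sup>2" by (rule power_mono[OF e2]) simp
  then have n4: "real n \<ge> 4" using n by simp
  have "exp 1 \<le> (exp 1)\<^sup>2 / (2::real)" using e2 by (simp add: power2_eq_square)
  then have en: "exp 1 \<le> real n" using n by (smt (verit) exp_gt_zero zero_less_power field_sum_of_halves)
  have Q1: "1 \<le> Q" unfolding Q_def using n4 \<epsilon> by (intro ge_one_powr_ge_zero) auto
  have p0: "0 < p" using p(1) by (smt (verit) powr_ge_zero)
  have "Q * real n powr (-1 + \<epsilon>) = 1" unfolding Q_def using n4 by (simp add: powr_add[symmetric])
  moreover have "Q * real n powr (-1 + \<epsilon>) \<le> Q * p" using p Q1 by (intro mult_left_mono) auto
  ultimately have pQ: "1 / p \<le> 1 + Q" using p0 by (simp add: field_simps)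
  have "real n powr 1 * real n powr - \<epsilon> = Q" unfolding Q_def by (subst powr_add[symmetric]) simp
  then have \<alpha>: "exp 1 / real n * (real (r ^ r) * Q) = \<alpha>" unfolding \<alpha>_def using n4 by (auto simp: field_simps)
  have \<alpha>0: "0 \<le> \<alpha>" by (simp add: \<alpha>_def)
  have \<gamma>0: "0 \<le> \<gamma>" by (simp add: \<gamma>_def)
  have \<gamma>: "\<gamma> \<le> (exp 1)\<^sup>2 / real n"
  proof -
    \<comment> \<open>As \<open>r \<ge> 3\<close>, a start loses at least two factors
      \<open>exp 1 / n\<close> against its one factor \<open>n\<close>.\<close>
    have "(exp 1 / real n) ^ (r - 1) \<le> (exp 1 / real n) ^ 2"
      using r en n4 by (intro power_decreasing) auto
    then have "\<gamma> \<le> real n * (exp 1 / real n) ^ 2" unfolding \<gamma>_def by (intro mult_left_mono) auto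
    then show ?thesis using n4 by (simp add: power_divide power2_eq_square)
  qed
  also have "\<dots> \<le> 1" using n n4 by simp
  finally have \<gamma>1: "\<gamma> \<le> 1" .
  \<comment> \<open>The price per vertex: the first term pays for the sets that cover a whole cycle
    without a start, the second for those with a start. Its \<open>6\<close> is 2 times the bound 3
    on \<open>exp 1\<close>.\<close>
  define c where "c = 1 / (real n)\<^sup>2 + 6 * (exp 1)\<^sup>2 * \<alpha> / real n"
  have factor: "(\<Sum>S\<in>Pow {..<m}. cycle_weight m r n \<alpha> \<gamma> S) \<le> exp (real m * c)" if "m \<in> set ms" for m
  proof -
    have m: "2 * real r \<le> real m * \<epsilon>" using ms[OF that] \<epsilon> by (simp add: field_simps)
    have "real m * \<epsilon> \<le> real m" using \<epsilon> by (simp add: mult_left_le)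
    then have rm: "r \<le> m" and m1: "1 \<le> real m" using m r by linarith+
    have mn: "m \<le> n" using member_le_sum_list[OF that] sum by linarith
    have "real n * (2 * \<alpha>) ^ m \<le> real n * (real n powr (-\<epsilon>/2)) ^ m"
      using small \<alpha>0 by (intro mult_left_mono power_mono) auto
    also have "\<dots> = real n powr 1 * real n powr (-\<epsilon>/2 * real m)"
      using n4 powr_realpow[of "real n powr (-\<epsilon>/2)" m] by (simp add: powr_powr)
    also have "\<dots> = real n powr (1 + - \<epsilon>/2 * real m)" by (rule powr_add[symmetric])
    also have "\<dots> \<le> real n powr (-2)"
    \<comment> \<open>From \<open>\<epsilon> * m \<ge> 2 * r\<close> and \<open>r \<ge> 3\<close>,
      the exponent is at most \<open>1 - r \<le> -2\<close>.\<close>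
    proof (rule powr_mono)
      show "1 + - \<epsilon>/2 * real m \<le> -2" using m r by (simp add: mult.commute)
    qed (use n4 in simp)
    also have "\<dots> = 1 / (real n)\<^sup>2" using n4 by (simp add: powr_minus divide_inverse powr_realpow[of _ 2, simplified])
    also have "\<dots> \<le> real m * (1 / (real n)\<^sup>2)" using mult_right_mono[OF m1, of "1 / (real n)\<^sup>2"] by simp
    finally have 1: "real n * (2 * \<alpha>) ^ m \<le> real m * (1 / (real n)\<^sup>2)" .
    have \<alpha>\<gamma>: "\<alpha> * \<gamma> \<le> \<alpha> * ((exp 1)\<^sup>2 / real n)" using \<gamma> \<alpha>0 by (rule mult_left_mono)
    \<comment> \<open>As \<open>m \<le> n\<close> and \<open>\<gamma>\<close> is at most of order
      \<open>1 / n\<close>, this power stays bounded even for cycles of linear length.\<close>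
    have "(1 + 2 * (\<alpha> * \<gamma>)) ^ m \<le> exp (2 * (\<alpha> * \<gamma>)) ^ m"
      using \<alpha>0 \<gamma>0 by (intro power_mono) auto
    also have "\<dots> = exp (real m * (2 * (\<alpha> * \<gamma>)))" by (simp add: exp_of_nat_mult)
    also have "\<dots> \<le> exp 1"
    proof -
      have "real m * (2 * (\<alpha> * \<gamma>)) \<le> real n * (2 * (\<alpha> * ((exp 1)\<^sup>2 / real n)))"
        by (rule mult_mono) (use mn \<alpha>\<gamma> \<alpha>0 \<gamma>0 in simp_all)
      also have "\<dots> = 2 * \<alpha> * (exp 1)\<^sup>2" using n4 by simp
      finally show ?thesis using small by simp
    qed
    also have "\<dots> \<le> 3" by (rule exp_le)
    finally have "2 * real m * (\<alpha> * \<gamma>) * (1 + 2 * (\<alpha> * \<gamma>)) ^ m \<le> 2 * real m * (\<alpha> * ((exp 1)\<^sup>2 / real n)) * 3"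
      by (intro mult_mono[OF mult_left_mono[OF \<alpha>\<gamma>]]) (use \<alpha>0 \<gamma>0 in simp_all)
    also have "\<dots> = real m * (6 * (exp 1)\<^sup>2 * \<alpha> / real n)" by simp
    finally have 2: "2 * real m * (\<alpha> * \<gamma>) * (1 + 2 * (\<alpha> * \<gamma>)) ^ m \<le> real m * (6 * (exp 1)\<^sup>2 * \<alpha> / real n)" .
    have "(\<Sum>S\<in>Pow {..<m}. cycle_weight m r n \<alpha> \<gamma> S)
        \<le> 1 + real n * (2 * \<alpha>) ^ m + 2 * real m * (\<alpha> * \<gamma>) * (1 + 2 * (\<alpha> * \<gamma>)) ^ m"
      by (rule sum_cycle_weight_le) (use rm \<alpha>0 \<gamma>0 \<gamma>1 small in auto)
    also have "\<dots> \<le> 1 + real m * c" using 1 2 unfolding c_def by (simp add: distrib_left)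
    also have "\<dots> \<le> exp (real m * c)" by (rule exp_ge_add_one_self)
    finally show ?thesis .
  qed
  have c0: "0 \<le> c" using \<alpha>0 by (simp add: c_def)
  have w0: "0 \<le> cycle_weight m r n \<alpha> \<gamma> S" for m S using \<alpha>0 \<gamma>0 by (simp add: cycle_weight_def)
  have "(\<Prod>i<length ms. \<Sum>S\<in>Pow {..<ms ! i}. cycle_weight (ms ! i) r n \<alpha> \<gamma> S)
      \<le> (\<Prod>i<length ms. exp (real (ms ! i) * c))"
    using factor w0 by (intro prod_mono conjI sum_nonneg) auto
  also have "\<dots> = exp (real (sum_list ms) * c)"
    by (simp add: exp_sum[symmetric] sum_distrib_right[symmetric] sum_list_sum_nth atLeast0LessThan)
  also have "\<dots> \<le> exp (real n * c)" using sum c0 by (simp add: mult_right_mono)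
  also have "real n * c = 1 / real n + 6 * (exp 1)\<^sup>2 * \<alpha>"
    using n4 by (simp add: c_def distrib_left power2_eq_square)
  finally have "(\<Prod>i<length ms. \<Sum>S\<in>Pow {..<ms ! i}. cycle_weight (ms ! i) r n \<alpha> \<gamma> S)
      \<le> exp (1 / real n + 6 * (exp 1)\<^sup>2 * \<alpha>)" .
  moreover have "r \<le> m" if "m \<in> set ms" for m
  proof -
    have "2 * real r \<le> real m * \<epsilon>" using ms[OF that] \<epsilon> by (simp add: field_simps)
    moreover have "real m * \<epsilon> \<le> real m" using \<epsilon> by (simp add: mult_left_le)
    ultimately show ?thesis by linarith
  qed
  ultimately show ?thesis
    using prob_disjoint_tight_cycles_ge[of r n ms p Q] r n4 sum p0 p(2) Q1 pQ
    unfolding \<alpha> \<gamma>_def by fastforce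
qed

theorem theorem5p1:
  fixes r :: nat and \<epsilon> \<delta> :: real
    and ns :: "nat \<Rightarrow> nat list" and p :: "nat \<Rightarrow> real"
  assumes "r \<ge> 3" and "\<epsilon> > 0" and "\<delta> > 0"
    and "\<forall>\<^sub>F n in sequentially. ns n \<noteq> [] \<and> real (hd (ns n)) \<ge> \<delta> * real n"
    and "\<forall>\<^sub>F n in sequentially. \<forall>m \<in> set (ns n). real m \<ge> 2 * real r / \<epsilon>"
    and "\<forall>\<^sub>F n in sequentially. sum_list (ns n) \<le> n"
    and "\<forall>\<^sub>F n in sequentially. real n powr (-1 + \<epsilon>) < p n \<and> p n \<le> 1"
  shows "(\<lambda>n. measure_pmf.prob (random_hypergraph r n (p n))
            {E. has_disjoint_tight_cycles r {1..n} E (ns n)}) \<longlonglongrightarrow> 1"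
proof -
  \<comment> \<open>Otherwise the lower bound on \<open>p\<close> would be at least 1 for
    \<open>n \<ge> 1\<close>, leaving no room below the upper bound.\<close>
  have "\<epsilon> < 1"
  proof (rule ccontr)
    assume "\<not> \<epsilon> < 1"
    then have "\<forall>\<^sub>F n in sequentially. 1 \<le> real n powr (-1 + \<epsilon>)"
      by (intro eventually_sequentiallyI[of 1] ge_one_powr_ge_zero) auto
    with assms(7) have "\<forall>\<^sub>F n in sequentially. False" by eventually_elim linarith
    then show False by simp
  qed
  define C where "C = exp 1 * real (r ^ r)"
  define \<alpha> where "\<alpha> = (\<lambda>n. C * real n powr - \<epsilon>)"
  have powr0: "(\<lambda>n. real n powr - s) \<longlonglongrightarrow> 0" if "s > 0" for s
    using that by (intro tendsto_neg_powr filterlim_real_sequentially) auto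
  have \<alpha>0: "(\<lambda>n. K * \<alpha> n) \<longlonglongrightarrow> 0" for K
    unfolding \<alpha>_def using tendsto_mult_right_zero[OF tendsto_mult_right_zero[OF powr0[OF assms(2)]]] by simp
  have small: "\<forall>\<^sub>F n in sequentially. K * \<alpha> n \<le> 1" for K
    using order_tendstoD(2)[OF \<alpha>0[of K], of 1] by (simp add: eventually_mono)
  \<comment> \<open>Split the power of \<open>n\<close> in \<open>\<alpha> n\<close> into two equal
    factors; one of them absorbs the constant \<open>2 * C\<close>.\<close>
  have half: "\<forall>\<^sub>F n in sequentially. 2 * \<alpha> n \<le> real n powr (- \<epsilon> / 2)"
  proof -
    have "(\<lambda>n. 2 * C * real n powr - (\<epsilon> / 2)) \<longlonglongrightarrow> 0"
      using assms(2) by (intro tendsto_mult_right_zero powr0) auto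
    then have "\<forall>\<^sub>F n in sequentially. 2 * C * real n powr - (\<epsilon> / 2) < 1"
      by (rule order_tendstoD(2)) simp
    then show ?thesis
    proof eventually_elim
      case (elim n)
      have "2 * \<alpha> n = 2 * C * real n powr - (\<epsilon> / 2) * real n powr (- \<epsilon> / 2)"
        unfolding \<alpha>_def by (simp add: powr_add[symmetric])
      also have "\<dots> \<le> 1 * real n powr (- \<epsilon> / 2)" using elim by (intro mult_right_mono) auto
      finally show ?case by simp
    qed
  qed
  have large: "\<forall>\<^sub>F n in sequentially. real n \<ge> (exp 1)\<^sup>2"
    using filterlim_real_sequentially by (simp add: filterlim_at_top)
  have lower: "\<forall>\<^sub>F n in sequentially. 2 - exp (1 / real n + 6 * (exp 1)\<^sup>2 * \<alpha> n)
      \<le> measure_pmf.prob (random_hypergraph r n (p n)) {E. has_disjoint_tight_cycles r {1..n} E (ns n)}"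
    using assms(5-7) large half small[of "2 * real r"] small[of "2 * (exp 1)\<^sup>2"]
  proof eventually_elim
    case (elim n)
    show ?case
      unfolding \<alpha>_def C_def
      by (rule prob_disjoint_tight_cycles_ge_exp[OF assms(1,2) \<open>\<epsilon> < 1\<close>])
         (use elim in \<open>auto simp: \<alpha>_def C_def mult_ac\<close>)
  qed
  \<comment> \<open>Both error terms vanish, so the lower bound tends to
    \<open>2 - exp 0 = 1\<close>; the upper bound 1 holds for every probability.\<close>
  have "(\<lambda>n. 2 - exp (1 / real n + 6 * (exp 1)\<^sup>2 * \<alpha> n)) \<longlonglongrightarrow> 2 - exp (0 + 0)"
    by (intro tendsto_intros lim_1_over_n \<alpha>0)
  then have "(\<lambda>n. 2 - exp (1 / real n + 6 * (exp 1)\<^sup>2 * \<alpha> n)) \<longlonglongrightarrow> 1" by simp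
  from tendsto_sandwich[OF lower _ this tendsto_const] show ?thesis by simp
qed

end
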